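(* Let $b\in\mathbb{R}$, $b>1$, and let $\phi$ be holomorphic in the strip $\{z\in\mathbb{C}: 0<\Re(z)<b\}$, such that for every $y\in\mathbb{R}$ the limit of $\phi(z)$ as $\Re(z)\to 0^+$ along $\Im(z)=y$ exists and is finite. Suppose there are $\alpha\in\mathbb{R}$ with $0\le\alpha<\pi/2$ and $C>0$ such that $|\phi(z)|<Ce^{\alpha|\Im(z)|}$ in the strip. Then $\phi$ can be indefinitely summed an arbitrary number of times: for every integer $n\ge1$, the $n$-fold iterate of the indefinite sum operator $\sum$ on $\phi$ is defined for $0<\Re(z)<b$ and $$\underbrace{\sum_z\cdots\sum_z}_{n\text{ times}}\phi=\mathcal{Y}_z\underbrace{\int_0^x\cdots\int_0^x}_{n\text{ times}}\mathcal{Y}_x^{-1}\phi .$$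
   Context: The Twisted Mellin transform of a function $g$ is $\mathcal{Y}_z g=\frac{1}{\Gamma(z)}\int_0^\infty e^{-t}g(t)t^{z-1}\,dt$, and its inverse is $\mathcal{Y}_x^{-1}\phi=\frac{e^x}{2\pi i}\int_{\sigma-i\infty}^{\sigma+i\infty}\Gamma(\xi)\phi(\xi)x^{-\xi}\,d\xi$ with any $0<\sigma<b$. The notation $\int_0^x$ denotes the operator sending a function $g$ to $x\mapsto\int_0^x g(u)\,du$; $n$ copies denote its $n$-fold iterate. $\Gamma$ is Euler's Gamma function. The indefinite sum operator sends a function $\phi$ on the strip $0<\Re(z)<b$ to the function $z\mapsto\sum_z\phi$ given by $$\sum_z\phi=\frac{1}{\Gamma(z)}\int_0^\infty e^{-t}t^{z-1}\int_0^t \frac{e^x}{2\pi i}\int_{\sigma-i\infty}^{\sigma+i\infty}\Gamma(\xi)\phi(\xi)x^{-\xi}\,d\xi\,dx\,dt,\qquad 0<\sigma<b,$$ i.e. $\sum_z\phi=\mathcal{Y}_z\int_0^x\mathcal{Y}_x^{-1}\phi$; it is an indefinite sum in the sense that $\sum_{z}\phi$ is holomorphic in the strip and $\sum_z\phi+\phi(z+1)=\sum_{z+1}\phi$ whenever $z,z+1$ lie in the strip. *)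

theory Defs
  imports "HOL-Complex_Analysis.Complex_Analysis"
begin

definition vstrip :: "real \<Rightarrow> complex set" where
  "vstrip b = {z. 0 < Re z \<and> Re z < b}"

text \<open>All integrals below are Lebesgue integrals. Each one comes with a predicate stating that it
  converges (absolutely), because the integral of a non-integrable function is 0 by convention.
  Functions on the positive half-line are represented by \<open>real \<Rightarrow> complex\<close>; only their values at
  positive arguments are ever used.\<close>

definition twisted_mellin_exists :: "(real \<Rightarrow> complex) \<Rightarrow> complex \<Rightarrow> bool" where
  "twisted_mellin_exists g z \<longleftrightarrow>
     set_integrable lborel {0<..} (\<lambda>t. of_real (exp (- t)) * g t * of_real t powr (z - 1))"

definition twisted_mellin :: "(real \<Rightarrow> complex) \<Rightarrow> complex \<Rightarrow> complex" where
  "twisted_mellin g z =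
     1 / Gamma z * (LINT t:{0<..}|lborel. of_real (exp (- t)) * g t * of_real t powr (z - 1))"

text \<open>The integral along the upward vertical line \<open>Re \<xi> = \<sigma>\<close>, parametrised by
  \<open>\<xi> = \<sigma> + \<i> y\<close>, so that \<open>d\<xi> = \<i> dy\<close>.\<close>

definition vline_integrable :: "real \<Rightarrow> (complex \<Rightarrow> complex) \<Rightarrow> bool" where
  "vline_integrable \<sigma> f \<longleftrightarrow> integrable lborel (\<lambda>y. f (Complex \<sigma> y))"

definition vline_integral :: "real \<Rightarrow> (complex \<Rightarrow> complex) \<Rightarrow> complex" where
  "vline_integral \<sigma> f = \<i> * (LINT y|lborel. f (Complex \<sigma> y))"

definition inv_twisted_mellin_exists :: "real \<Rightarrow> (complex \<Rightarrow> complex) \<Rightarrow> real \<Rightarrow> bool" where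
  "inv_twisted_mellin_exists \<sigma> \<phi> x \<longleftrightarrow>
     vline_integrable \<sigma> (\<lambda>\<xi>. Gamma \<xi> * \<phi> \<xi> * of_real x powr (- \<xi>))"

definition inv_twisted_mellin :: "real \<Rightarrow> (complex \<Rightarrow> complex) \<Rightarrow> real \<Rightarrow> complex" where
  "inv_twisted_mellin \<sigma> \<phi> x =
     of_real (exp x) / (2 * of_real pi * \<i>) *
       vline_integral \<sigma> (\<lambda>\<xi>. Gamma \<xi> * \<phi> \<xi> * of_real x powr (- \<xi>))"

definition int_from_0_exists :: "(real \<Rightarrow> complex) \<Rightarrow> real \<Rightarrow> bool" where
  "int_from_0_exists g x \<longleftrightarrow> set_integrable lborel {0<..<x} g"

definition int_from_0 :: "(real \<Rightarrow> complex) \<Rightarrow> real \<Rightarrow> complex" where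
  "int_from_0 g x = (LINT u:{0<..<x}|lborel. g u)"

text \<open>The indefinite sum operator, with the abscissa \<open>\<sigma>\<close> of the inner line integral as an explicit
  parameter, and the convergence of all three nested integrals in it.\<close>

definition indef_sum :: "real \<Rightarrow> (complex \<Rightarrow> complex) \<Rightarrow> complex \<Rightarrow> complex" where
  "indef_sum \<sigma> \<phi> z = twisted_mellin (int_from_0 (inv_twisted_mellin \<sigma> \<phi>)) z"

definition indef_sum_exists :: "real \<Rightarrow> (complex \<Rightarrow> complex) \<Rightarrow> complex \<Rightarrow> bool" where
  "indef_sum_exists \<sigma> \<phi> z \<longleftrightarrow>
     (\<forall>x>0. inv_twisted_mellin_exists \<sigma> \<phi> x) \<and>
     (\<forall>t>0. int_from_0_exists (inv_twisted_mellin \<sigma> \<phi>) t) \<and>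
     twisted_mellin_exists (int_from_0 (inv_twisted_mellin \<sigma> \<phi>)) z"

text \<open>The iterate may use a different abscissa \<open>\<sigma> k\<close> in each application of the operator.\<close>

primrec indef_sum_iter :: "(nat \<Rightarrow> real) \<Rightarrow> nat \<Rightarrow> (complex \<Rightarrow> complex) \<Rightarrow> complex \<Rightarrow> complex" where
  "indef_sum_iter \<sigma> 0 \<phi> = \<phi>"
| "indef_sum_iter \<sigma> (Suc k) \<phi> = indef_sum (\<sigma> k) (indef_sum_iter \<sigma> k \<phi>)"

definition is_indefinite_sum :: "real \<Rightarrow> (complex \<Rightarrow> complex) \<Rightarrow> (complex \<Rightarrow> complex) \<Rightarrow> bool" where
  "is_indefinite_sum b \<phi> \<psi> \<longleftrightarrow>
     \<psi> holomorphic_on vstrip b \<and>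
     (\<forall>z. z \<in> vstrip b \<and> z + 1 \<in> vstrip b \<longrightarrow> \<psi> z + \<phi> (z + 1) = \<psi> (z + 1))"

end

theory Submission
  imports Defs "HOL-Probability.Probability" "HOL-Real_Asymp.Real_Asymp"
begin

text \<open>
  Up to the factors \<open>e\<^sup>x\<close> and \<open>\<Gamma>\<close> the twisted transforms are the Mellin transform and its inverse, so the
  claim amounts to Mellin inversion for \<open>h\<^sub>k(t) = e\<^sup>-\<^sup>t f\<^sub>k(t)\<close>, where \<open>f\<^sub>k\<close> is the \<open>k\<close>-fold integral of the
  inverse transform of \<open>\<phi>\<close>: once \<open>f\<^sub>k\<close> is recovered from \<open>\<Sum>\<^sup>k \<phi>\<close>, the next summation integrates it once
  more. Inversion holds for every twice continuously differentiable \<open>h\<close> with \<open>h\<^sup>(\<^sup>j\<^sup>)(t) = O(t\<^sup>-\<^sup>\<sigma>\<^sup>-\<^sup>j)\<close> for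
  \<open>j \<le> 2\<close> and all \<open>0 < \<sigma> < b\<close>, since two integrations by parts make its Mellin transform
  integrable on vertical lines. This class contains \<open>h\<^sub>0\<close>, because \<open>\<Gamma>\<phi>\<close> decays exponentially on
  vertical lines and the line of integration can be moved within the strip, and it is preserved by
  \<open>h\<^sub>k \<mapsto> h\<^sub>k\<^sub>+\<^sub>1\<close>, because \<open>h\<^sub>k\<^sub>+\<^sub>1' = h\<^sub>k - h\<^sub>k\<^sub>+\<^sub>1\<close>. The same equation, integrated by parts, is the
  summation identity.
\<close>

section \<open>Parametric integrals and Fourier inversion\<close>

text \<open>The exponential bound on \<phi> is not propagated to its sums: for the product of
  \<Gamma> with an iterated sum only quadratic decay on vertical lines is established. The induction
  therefore runs on the real side, on the functions h_k, and reaches the complex side only through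
  inversion. The delicate point on the real side is large t, where the iterated integrals may grow
  almost like exp t. Decay of h_(k+1) is obtained by reading its derivative formula as a
  differential equation whose solutions relax exponentially towards the forcing term h_k.
  Differentiating the equation keeps its form, so one estimate serves the function and both
  derivatives. Near 0 the bounds come instead from the boundedness of the indefinite integral. For
  h_0 no differentiated integral has to be estimated: the exponential decay of \<Gamma>\<phi> makes
  h_0 an analytic function of ln t in a strip around the real axis, and Cauchy's inequality bounds
  its derivatives of every order.\<close>

lemma holomorphic_on_parametric_integral:
  fixes f :: "complex \<Rightarrow> 'a \<Rightarrow> complex"
  assumes "open S"
    and hol: "\<And>t. t \<in> space M \<Longrightarrow> (\<lambda>z. f z t) holomorphic_on S"
    and meas: "\<And>z. z \<in> S \<Longrightarrow> f z \<in> borel_measurable M"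
    and dom: "\<And>z. z \<in> S \<Longrightarrow> \<exists>r>0. \<exists>g. ball z r \<subseteq> S \<and> integrable M g \<and>
                (\<forall>w\<in>ball z r. \<forall>t\<in>space M. norm (f w t) \<le> g t)"
  shows "(\<lambda>z. LINT t|M. f z t) holomorphic_on S"
proof -
  have "(\<lambda>z. LINT t|M. f z t) field_differentiable (at z)" if z: "z \<in> S" for z
  proof -
    obtain r g where r: "r > 0" "ball z r \<subseteq> S" and g: "integrable M g"
      and bd: "\<And>w t. w \<in> ball z r \<Longrightarrow> t \<in> space M \<Longrightarrow> norm (f w t) \<le> g t"
      using dom[OF z] by metis
    have int: "integrable M (f w)" if "w \<in> ball z r" for w
      by (rule Bochner_Integration.integrable_bound[OF g])
         (use that r meas bd in \<open>auto intro!: AE_I2 intro: order_trans[OF bd]\<close>)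
    define D where "D = (\<lambda>t. deriv (\<lambda>z. f z t) z)"
    \<comment> \<open>A circle of radius r/3 about a point of the half ball stays in the ball, as
      r/2 + r/3 < r. Cauchy's inequality there bounds the derivative by 3 g / r, which dominates all
      difference quotients at once.\<close>
    have lip: "norm ((f w t - f z t) / (w - z)) \<le> 3 * g t / r"
      if w: "w \<in> ball z (r/2)" "w \<noteq> z" and t: "t \<in> space M" for w t
    proof -
      have holt: "(\<lambda>z. f z t) holomorphic_on ball z r"
        using hol[OF t] r(2) by (rule holomorphic_on_subset)
      have "norm (f w t - f z t) \<le> 3 * g t / r * norm (w - z)"
      proof (rule field_differentiable_bound[where S = "ball z (r/2)" and f = "\<lambda>z. f z t"
               and f' = "deriv (\<lambda>z. f z t)"])
        fix v assume v: "v \<in> ball z (r/2)"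
        have vr: "v \<in> ball z r" using v r by auto
        show "((\<lambda>z. f z t) has_field_derivative deriv (\<lambda>z. f z t) v) (at v within ball z (r/2))"
          using holomorphic_derivI[OF holt open_ball vr] has_field_derivative_at_within by blast
        have sub: "u \<in> ball z r" if "norm (v - u) < r / 2" for u
          using dist_triangle[of z u v] v that by (auto simp: dist_norm)
        have "norm ((deriv ^^ 1) (\<lambda>z. f z t) v) \<le> fact 1 * g t / (r/3) ^ 1"
        proof (rule Cauchy_inequality)
          have "cball v (r/3) \<subseteq> ball z r"
          proof
            fix u assume "u \<in> cball v (r/3)"
            then show "u \<in> ball z r" using r by (intro sub) (auto simp: dist_norm)
          qed
          then show "(\<lambda>z. f z t) holomorphic_on ball v (r/3)" "continuous_on (cball v (r/3)) (\<lambda>z. f z t)"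
            using holt by (auto intro: holomorphic_on_subset holomorphic_on_imp_continuous_on
                dest: order_trans[OF ball_subset_cball])
        next
          fix u assume "norm (v - u) = r / 3"
          then show "norm (f u t) \<le> g t" using r t by (intro bd sub) auto
        qed (use r in auto)
        then show "norm (deriv (\<lambda>z. f z t) v) \<le> 3 * g t / r"
          using r by (simp add: field_simps)
      qed (use w r in auto)
      then show ?thesis using w by (simp add: norm_divide field_simps)
    qed
    have "((\<lambda>w. ((LINT t|M. f w t) - (LINT t|M. f z t)) / (w - z)) \<longlongrightarrow> (LINT t|M. D t)) (at z)"
      unfolding tendsto_at_iff_sequentially comp_def
    proof (intro allI impI)
      fix X :: "nat \<Rightarrow> complex" assume X: "\<forall>i. X i \<in> UNIV - {z}" "X \<longlonglongrightarrow> z"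
      then obtain N where N: "\<And>n. n \<ge> N \<Longrightarrow> X n \<in> ball z (r/2)"
        using r unfolding lim_sequentially
        by (metis dist_commute half_gt_zero mem_ball)
      \<comment> \<open>Dropping the first \<open>N\<close> terms puts the whole sequence into the
        half ball, where the domination holds.\<close>
      define Y where "Y = (\<lambda>n. X (n + N))"
      have Y: "Y n \<in> ball z (r/2)" "Y n \<in> ball z r" "Y n \<noteq> z" for n
        using X(1) N[of "n + N"] r unfolding Y_def by auto
      have Ylim: "Y \<longlonglongrightarrow> z" unfolding Y_def using X(2) by (rule LIMSEQ_ignore_initial_segment)
      have lim: "(\<lambda>n. (f (Y n) t - f z t) / (Y n - z)) \<longlonglongrightarrow> D t" if t: "t \<in> space M" for t
      proof -
        have "((\<lambda>z. f z t) has_field_derivative D t) (at z)"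
          unfolding D_def using holomorphic_derivI[OF hol[OF t] \<open>open S\<close> z] .
        then have "((\<lambda>w. (f w t - f z t) / (w - z)) \<longlongrightarrow> D t) (at z)"
          by (simp add: has_field_derivative_iff)
        then show ?thesis
          using Y Ylim unfolding tendsto_at_iff_sequentially comp_def by auto
      qed
      have mY: "(\<lambda>t. (f (Y n) t - f z t) / (Y n - z)) \<in> borel_measurable M" for n
        using meas[OF z] meas[of "Y n"] subsetD[OF r(2) Y(2)[of n]]
        by (auto intro!: borel_measurable_divide borel_measurable_diff)
      have "(\<lambda>n. LINT t|M. (f (Y n) t - f z t) / (Y n - z)) \<longlonglongrightarrow> (LINT t|M. D t)"
      proof (rule integral_dominated_convergence[where w = "\<lambda>t. 3 * g t / r"])
        show "D \<in> borel_measurable M"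
          by (rule borel_measurable_LIMSEQ_metric[OF mY lim])
      qed (use g mY lim lip Y in auto)
      also have "(\<lambda>n. LINT t|M. (f (Y n) t - f z t) / (Y n - z)) =
          (\<lambda>n. ((LINT t|M. f (Y n) t) - (LINT t|M. f z t)) / (Y n - z))"
        using int Y r by (auto simp: Bochner_Integration.integral_diff)
      finally show "(\<lambda>n. ((LINT t|M. f (X n) t) - (LINT t|M. f z t)) / (X n - z)) \<longlonglongrightarrow> (LINT t|M. D t)"
        unfolding Y_def by (rule LIMSEQ_offset)
    qed
    then show ?thesis unfolding field_differentiable_def has_field_derivative_iff by blast
  qed
  then show ?thesis
    unfolding holomorphic_on_def using field_differentiable_at_within by blast
qed

lemma exp_substitution:
  fixes f :: "real \<Rightarrow> complex"
  assumes "continuous_on {0<..} f"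
  shows "set_integrable lborel {0<..} f \<longleftrightarrow> integrable lborel (\<lambda>s. exp s *\<^sub>R f (exp s))"
    and "set_integrable lborel {0<..} f \<Longrightarrow>
      (LINT t:{0<..}|lborel. f t) = (LINT s|lborel. exp s *\<^sub>R f (exp s))"
proof -
  have range: "range exp = {0::real<..}"
    by (auto simp: image_iff) (metis exp_ln)
  have cont: "continuous_on UNIV (\<lambda>s. exp s *\<^sub>R f (exp s))"
    by (intro continuous_intros continuous_on_compose2[OF assms]) auto
  have m1: "(\<lambda>s. exp s *\<^sub>R f (exp s)) \<in> borel_measurable lborel"
    using borel_measurable_continuous_onI[OF cont] by simp
  have m2: "(\<lambda>t. indicator {0<..} t *\<^sub>R f t) \<in> borel_measurable lborel"
    using borel_measurable_continuous_on_indicator[OF _ assms] by simp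
  \<comment> \<open>The change of variables concerns absolute integrability for the completed
    measure; Borel measurability of both integrands, a consequence of continuity, carries it over to
    \<open>lborel\<close>.\<close>
  have e1: "set_integrable lborel {0<..} f \<longleftrightarrow> f absolutely_integrable_on {0<..}"
    unfolding set_integrable_def using integrable_completion[OF m2] by simp
  have e2: "integrable lborel (\<lambda>s. exp s *\<^sub>R f (exp s)) \<longleftrightarrow>
      (\<lambda>s. exp s *\<^sub>R f (exp s)) absolutely_integrable_on UNIV"
    unfolding set_integrable_def using integrable_completion[OF m1] by simp
  note cov = has_absolute_integral_change_of_variables_real[of UNIV exp exp f, unfolded range, simplified]
  show iff: "set_integrable lborel {0<..} f \<longleftrightarrow> integrable lborel (\<lambda>s. exp s *\<^sub>R f (exp s))"
    unfolding e1 e2 using cov by (auto intro: inj_onI)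
  assume i: "set_integrable lborel {0<..} f"
  have "(LINT t:{0<..}|lborel. f t) = integral {0<..} f"
    using set_borel_integral_eq_integral(2)[OF i] .
  also have "\<dots> = integral UNIV (\<lambda>s. exp s *\<^sub>R f (exp s))"
    using cov i iff unfolding e1 e2 by (metis inj_onI exp_inj_iff)
  also have "\<dots> = (LINT s|lborel. exp s *\<^sub>R f (exp s))"
    using i iff integral_lborel by blast
  finally show "(LINT t:{0<..}|lborel. f t) = (LINT s|lborel. exp s *\<^sub>R f (exp s))" .
qed

section \<open>Fourier inversion by Gaussian regularisation\<close>

lemma integral_cis_gaussian:
  "(LINT y|lborel. cis (a * y) * of_real (exp (- y\<^sup>2 / 2))) = of_real (sqrt (2 * pi) * exp (- a\<^sup>2 / 2))"
proof -
  have "of_real (exp (- a\<^sup>2 / 2)) = char std_normal_distribution a"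
    by (simp add: char_std_normal_distribution)
  also have "\<dots> = (LINT x|lborel. std_normal_density x *\<^sub>R iexp (a * x))"
    unfolding char_def by (subst integral_density) (auto simp: normal_density_nonneg)
  also have "\<dots> = (LINT x|lborel. of_real (1 / sqrt (2 * pi)) * (cis (a * x) * of_real (exp (- x\<^sup>2 / 2))))"
    by (intro Bochner_Integration.integral_cong)
       (auto simp: std_normal_density_def cis_conv_exp scaleR_conv_of_real)
  also have "\<dots> = of_real (1 / sqrt (2 * pi)) * (LINT y|lborel. cis (a * y) * of_real (exp (- y\<^sup>2 / 2)))"
    by (rule integral_mult_right_zero)
  finally show ?thesis by (simp add: field_simps)
qed

lemma integral_cis_gaussian_scaled:
  assumes "n > 0"
  shows "(LINT y|lborel. cis (a * y) * of_real (exp (- (y / n)\<^sup>2 / 2))) =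
    of_real (n * sqrt (2 * pi) * exp (- (n * a)\<^sup>2 / 2))"
  using assms integral_cis_gaussian[of "n * a"]
  by (subst lborel_integral_real_affine[where c = n and t = 0])
     (auto simp: scaleR_conv_of_real mult_ac)

lemma integrable_gaussian: "integrable lborel (\<lambda>y::real. exp (- y\<^sup>2 / 2))"
proof -
  have "integrable lborel (\<lambda>y. sqrt (2 * pi) * (std_normal_density y * y ^ 0))"
    by (intro integrable_mult_right integrable_std_normal_moment)
  then show ?thesis by (simp add: std_normal_density_def)
qed

text \<open>A Gaussian factor \<open>e n\<close> makes the double integral absolutely convergent, so
  Fubini turns the damped inverse transform into an average of \<open>G\<close> around
  \<open>s\<close> with a Gaussian of width 1 / Suc n. As n grows, the damping disappears on one
  side, dominated by the integrable transform, and the average tends to \<open>G s\<close> on the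
  other, dominated through \<open>B\<close>. Of the two factors sqrt (2 * pi), one comes from the
  transform of the Gaussian and one from its mass.\<close>

theorem fourier_inversion:
  fixes G :: "real \<Rightarrow> complex"
  assumes cont: "continuous_on UNIV G" and bd: "\<And>u. norm (G u) \<le> B"
    and G: "integrable lborel G"
    and FG: "integrable lborel (\<lambda>y. LINT u|lborel. G u * cis (u * y))"
  shows "2 * pi * G s = (LINT y|lborel. (LINT u|lborel. G u * cis (u * y)) * cis (- (s * y)))"
proof -
  let ?F = "\<lambda>y. LINT u|lborel. G u * cis (u * y)"
  define e where "e = (\<lambda>n y. exp (- (y / real (Suc n))\<^sup>2 / 2))"
  have [measurable]: "G \<in> borel_measurable borel" "?F \<in> borel_measurable borel"
    using G FG by auto
  have cis_meas [measurable]: "cis \<in> borel_measurable borel"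
    by (intro borel_measurable_continuous_onI continuous_intros)
  have e_meas [measurable]: "e n \<in> borel_measurable borel" for n
    unfolding e_def by measurable
  have e_int: "integrable lborel (e n)" for n
    using lborel_integrable_real_affine[OF integrable_gaussian, of "1 / real (Suc n)" 0]
    unfolding e_def by (simp add: field_simps)
  \<comment> \<open>The limit 1 of the damping factor is kept as
    \<open>exp (- 0\<^sup>2 / 2)\<close>, the form in which the limit rules produce it from y / Suc
    n tending to 0.\<close>
  have "(\<lambda>n. LINT y|lborel. ?F y * cis (- (s * y)) * of_real (e n y)) \<longlonglongrightarrow>
        (LINT y|lborel. ?F y * cis (- (s * y)) * of_real (exp (- 0\<^sup>2 / 2)))"
  proof (rule integral_dominated_convergence[where w = "\<lambda>y. norm (?F y)"])
    have "(\<lambda>n. e n y) \<longlonglongrightarrow> exp (- 0\<^sup>2 / 2)" for y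
      unfolding e_def by (intro tendsto_intros LIMSEQ_Suc[OF lim_const_over_n]) auto
    then show "AE y in lborel. (\<lambda>n. ?F y * cis (- (s * y)) * of_real (e n y)) \<longlonglongrightarrow>
        ?F y * cis (- (s * y)) * of_real (exp (- 0\<^sup>2 / 2))"
      by (intro AE_I2 tendsto_intros) auto
    show "AE y in lborel. norm (?F y * cis (- (s * y)) * of_real (e n y)) \<le> norm (?F y)" for n
      by (auto simp: norm_mult e_def intro!: AE_I2 mult_left_le)
  qed (use FG in auto)
  then have lim1: "(\<lambda>n. LINT y|lborel. ?F y * cis (- (s * y)) * of_real (e n y)) \<longlonglongrightarrow>
        (LINT y|lborel. ?F y * cis (- (s * y)))" by simp
  have rescale: "(LINT u|lborel. G u * of_real (N * c * exp (- (N * (u - s))\<^sup>2 / 2))) =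
      (LINT v|lborel. of_real c * (G (s + v / N) * of_real (exp (- v\<^sup>2 / 2))))" if N: "N > 0" for N c
  proof -
    have "(LINT u|lborel. G u * of_real (N * c * exp (- (N * (u - s))\<^sup>2 / 2))) =
        (LINT v|lborel. of_real (1 / N) * (G (s + 1 / N * v) * of_real (N * c * exp (- (N * (s + 1 / N * v - s))\<^sup>2 / 2))))"
      using N by (subst lborel_integral_real_affine[where c = "1 / N" and t = s])
        (auto simp: scaleR_conv_of_real simp flip: integral_mult_right_zero)
    also have "(\<lambda>v. of_real (1 / N) * (G (s + 1 / N * v) * of_real (N * c * exp (- (N * (s + 1 / N * v - s))\<^sup>2 / 2)))) =
        (\<lambda>v. of_real c * (G (s + v / N) * of_real (exp (- v\<^sup>2 / 2))))"
      using N by auto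
    finally show ?thesis .
  qed
  have eq: "(LINT y|lborel. ?F y * cis (- (s * y)) * of_real (e n y)) =
     of_real (sqrt (2 * pi)) * (LINT v|lborel. G (s + v / Suc n) * of_real (exp (- v\<^sup>2 / 2)))" for n
  proof -
    define K where "K = (\<lambda>u y. G u * (cis ((u - s) * y) * of_real (e n y)))"
    have K_int: "integrable (lborel \<Otimes>\<^sub>M lborel) (\<lambda>(u, y). K u y)"
    proof (rule lborel_pair.Fubini_integrable)
      show "(\<lambda>(u, y). K u y) \<in> borel_measurable (lborel \<Otimes>\<^sub>M lborel)"
        unfolding K_def by measurable
      have "(LINT y|lborel. norm (K u y)) = norm (G u) * (LINT y|lborel. e n y)" for u
        by (simp add: K_def norm_mult e_def)
      then show "integrable lborel (\<lambda>u. LINT y|lborel. norm (case (u, y) of (u, y) \<Rightarrow> K u y))"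
        using G by simp
      have "integrable lborel (K u)" for u
        unfolding K_def
        by (intro integrable_mult_right Bochner_Integration.integrable_bound[OF e_int[of n]])
           (auto simp: norm_mult e_def)
      then show "AE u in lborel. integrable lborel (\<lambda>y. case (u, y) of (u, y) \<Rightarrow> K u y)"
        by auto
    qed
    have "(LINT y|lborel. ?F y * cis (- (s * y)) * of_real (e n y)) = (LINT y|lborel. LINT u|lborel. K u y)"
    proof (intro Bochner_Integration.integral_cong refl)
      fix y
      have "?F y * cis (- (s * y)) * of_real (e n y) =
          (LINT u|lborel. G u * cis (u * y) * (cis (- (s * y)) * of_real (e n y)))"
        by (simp add: mult.assoc flip: integral_mult_left_zero)
      also have "\<dots> = (LINT u|lborel. K u y)"
        by (intro Bochner_Integration.integral_cong) (auto simp: K_def cis_mult[symmetric] algebra_simps cis_mult)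
      finally show "?F y * cis (- (s * y)) * of_real (e n y) = (LINT u|lborel. K u y)" .
    qed
    also have "\<dots> = (LINT u|lborel. LINT y|lborel. K u y)"
      using lborel_pair.Fubini_integral[OF K_int] .
    also have "\<dots> = (LINT u|lborel. G u * of_real (Suc n * sqrt (2 * pi) * exp (- (Suc n * (u - s))\<^sup>2 / 2)))"
      unfolding K_def e_def by (subst integral_mult_right_zero) (simp only: integral_cis_gaussian_scaled of_nat_0_less_iff zero_less_Suc)
    also have "\<dots> = (LINT v|lborel. of_real (sqrt (2 * pi)) * (G (s + v / Suc n) * of_real (exp (- v\<^sup>2 / 2))))"
      by (rule rescale) simp
    finally show ?thesis by simp
  qed
  have "(\<lambda>n. LINT v|lborel. G (s + v / Suc n) * of_real (exp (- v\<^sup>2 / 2))) \<longlonglongrightarrow>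
        (LINT v|lborel. G s * of_real (exp (- v\<^sup>2 / 2)))"
  proof (rule integral_dominated_convergence[where w = "\<lambda>v. B * exp (- v\<^sup>2 / 2)"])
    have "(\<lambda>n. G (s + v / Suc n)) \<longlonglongrightarrow> G s" for v
    proof (rule continuous_on_tendsto_compose[OF cont])
      have "(\<lambda>n. s + v / real (Suc n)) \<longlonglongrightarrow> s + 0"
        by (intro tendsto_intros LIMSEQ_Suc[OF lim_const_over_n])
      then show "(\<lambda>n. s + v / Suc n) \<longlonglongrightarrow> s" by simp
    qed auto
    then show "AE v in lborel. (\<lambda>n. G (s + v / Suc n) * of_real (exp (- v\<^sup>2 / 2))) \<longlonglongrightarrow> G s * of_real (exp (- v\<^sup>2 / 2))"
      by (intro AE_I2 tendsto_intros) auto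
    show "AE v in lborel. norm (G (s + v / Suc n) * of_real (exp (- v\<^sup>2 / 2))) \<le> B * exp (- v\<^sup>2 / 2)" for n
      using bd by (auto simp: norm_mult)
  qed (use integrable_gaussian in auto)
  moreover have "(LINT v|lborel. G s * of_real (exp (- v\<^sup>2 / 2))) = G s * of_real (sqrt (2 * pi))"
    using integral_cis_gaussian[of 0] by simp
  ultimately have "(\<lambda>n. LINT y|lborel. ?F y * cis (- (s * y)) * of_real (e n y)) \<longlonglongrightarrow>
      of_real (sqrt (2 * pi)) * (G s * of_real (sqrt (2 * pi)))"
    unfolding eq by (intro tendsto_mult tendsto_const) (simp only:)
  with lim1 have "(LINT y|lborel. ?F y * cis (- (s * y))) = of_real (sqrt (2 * pi)) * (G s * of_real (sqrt (2 * pi)))"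
    using LIMSEQ_unique by blast
  also have "\<dots> = of_real (sqrt (2 * pi) * sqrt (2 * pi)) * G s"
    by (simp only: of_real_mult mult_ac)
  finally show ?thesis by simp
qed

section \<open>Decay of the Gamma function on vertical lines\<close>

text \<open>By the Gauss product, \<open>|\<Gamma>(a + iy)| / \<Gamma>(a)\<close> is increasing in \<open>a > 0\<close>; this reduces the decay of
  \<open>\<Gamma>\<close> along vertical lines to the half-integers, where the reflection formula gives it exactly.\<close>

lemma norm_Gamma_ratio_mono:
  assumes "0 < a" "a \<le> c"
  shows "norm (Gamma (Complex a y)) * Gamma c \<le> Gamma a * norm (Gamma (Complex c y))"
proof (rule LIMSEQ_le)
  show "(\<lambda>n. norm (Gamma_series (Complex a y) n) * Gamma_series c n) \<longlonglongrightarrow> norm (Gamma (Complex a y)) * Gamma c"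
    "(\<lambda>n. Gamma_series a n * norm (Gamma_series (Complex c y) n)) \<longlonglongrightarrow> Gamma a * norm (Gamma (Complex c y))"
    by (intro tendsto_intros Gamma_series_LIMSEQ)+
  have series: "norm (Gamma_series (Complex x y) n) =
      fact n * exp (x * ln (real n)) / (\<Prod>k=0..n. norm (Complex (x + real k) y))" for x n
  proof -
    have "Complex x y + of_nat k = Complex (x + real k) y" for k :: nat
      by (simp add: complex_eq_iff)
    then show ?thesis
      by (simp add: Gamma_series_def norm_divide norm_mult pochhammer_prod prod_norm atLeastLessThanSuc_atLeastAtMost
           flip: prod_norm)
  qed
  have series': "Gamma_series x n = fact n * exp (x * ln (real n)) / (\<Prod>k=0..n. (x + real k))" for x :: real and n
    by (simp add: Gamma_series_def pochhammer_prod atLeastLessThanSuc_atLeastAtMost)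
  have "norm (Gamma_series (Complex a y) n) * Gamma_series c n
      \<le> Gamma_series a n * norm (Gamma_series (Complex c y) n)" for n
  proof -
    \<comment> \<open>The ratio (a + k) / |a + k + iy| increases with a: after squaring and
      cross-multiplying, the common term (a + k)^2 (c + k)^2 drops out. The remaining factors of the
      Gauss products agree on both sides.\<close>
    have fac: "(a + real k) * norm (Complex (c + real k) y) \<le> norm (Complex (a + real k) y) * (c + real k)" for k :: nat
    proof (rule power2_le_imp_le)
      have "(a + real k)\<^sup>2 \<le> (c + real k)\<^sup>2" using assms by (intro power_mono) auto
      then have "(a + real k)\<^sup>2 * y\<^sup>2 \<le> (c + real k)\<^sup>2 * y\<^sup>2" by (rule mult_right_mono) auto
      then show "((a + real k) * norm (Complex (c + real k) y))\<^sup>2 \<le> (norm (Complex (a + real k) y) * (c + real k))\<^sup>2"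
        unfolding power_mult_distrib cmod_power2 complex.sel by (simp add: distrib_left distrib_right mult.commute)
    qed (use assms in auto)
    have "(\<Prod>k=0..n. (a + real k) * norm (Complex (c + real k) y)) \<le> (\<Prod>k=0..n. norm (Complex (a + real k) y) * (c + real k))"
      using assms fac by (intro prod_mono) auto
    then have le: "(\<Prod>k=0..n. (a + real k)) * (\<Prod>k=0..n. norm (Complex (c + real k) y))
        \<le> (\<Prod>k=0..n. norm (Complex (a + real k) y)) * (\<Prod>k=0..n. (c + real k))"
      by (simp add: prod.distrib)
    have nz: "Complex (x + real k) y \<noteq> 0" if "x > 0" for x :: real and k
      using that by (simp add: complex_eq_iff)
    have pos: "(\<Prod>k=0..n. (a + real k)) > 0" "(\<Prod>k=0..n. (c + real k)) > 0"
       "(\<Prod>k=0..n. norm (Complex (c + real k) y)) > 0" "(\<Prod>k=0..n. norm (Complex (a + real k) y)) > 0"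
      using assms nz by (auto intro!: prod_pos add_pos_nonneg)
    define E where "E = fact n * exp (a * ln (real n)) * (fact n * exp (c * ln (real n)))"
    have "norm (Gamma_series (Complex a y) n) * Gamma_series c n =
        E / ((\<Prod>k=0..n. norm (Complex (a + real k) y)) * (\<Prod>k=0..n. (c + real k)))"
      unfolding series series' E_def by simp
    also have "\<dots> \<le> E / ((\<Prod>k=0..n. (a + real k)) * (\<Prod>k=0..n. norm (Complex (c + real k) y)))"
      using pos le by (intro divide_left_mono mult_pos_pos) (auto simp: E_def)
    also have "\<dots> = Gamma_series a n * norm (Gamma_series (Complex c y) n)"
      unfolding series series' E_def by simp
    finally show ?thesis .
  qed
  then show "\<exists>N. \<forall>n\<ge>N. norm (Gamma_series (Complex a y) n) * Gamma_series c n
      \<le> Gamma_series a n * norm (Gamma_series (Complex c y) n)" by blast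
qed

text \<open>On this line conjugation is z -> 1 - z, so the reflection formula evaluates |\<Gamma>|^2
  as pi / |sin (pi z)| = pi / cosh (pi y). The bound keeps only the larger exponential of
  cosh.\<close>

lemma norm_Gamma_half_le: "norm (Gamma (Complex (1/2) y)) \<le> sqrt (2 * pi) * exp (- pi / 2 * \<bar>y\<bar>)"
proof (rule power2_le_imp_le)
  let ?z = "Complex (1/2) y"
  have cnj: "cnj ?z = 1 - ?z" by (simp add: complex_eq_iff)
  have "norm (sin (pi * ?z)) \<ge> exp (pi * \<bar>y\<bar>) / 2"
  proof (rule power2_le_imp_le)
    have "(exp (pi * \<bar>y\<bar>))\<^sup>2 \<le> exp (2 * (pi * y)) + inverse (exp (2 * (pi * y)))"
      by (cases "y \<ge> 0") (auto simp: power2_eq_square exp_minus[symmetric] mult.assoc simp flip: exp_add)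
    then show "(exp (pi * \<bar>y\<bar>) / 2)\<^sup>2 \<le> (norm (sin (pi * ?z)))\<^sup>2"
      unfolding norm_sin_squared by (simp add: power_divide)
  qed auto
  then have "pi / norm (sin (pi * ?z)) \<le> pi / (exp (pi * \<bar>y\<bar>) / 2)"
    by (intro divide_left_mono mult_pos_pos) (auto intro: less_le_trans[of 0 "exp (pi * \<bar>y\<bar>) / 2"])
  moreover have "(norm (Gamma ?z))\<^sup>2 = norm (Gamma ?z * Gamma (1 - ?z))"
    unfolding cnj[symmetric] cnj_Gamma[symmetric] by (simp add: norm_mult power2_eq_square)
  then have "(norm (Gamma ?z))\<^sup>2 = pi / norm (sin (pi * ?z))"
    unfolding Gamma_reflection_complex by (simp add: norm_divide)
  moreover have "pi / (exp (pi * \<bar>y\<bar>) / 2) = (sqrt (2 * pi) * exp (- pi / 2 * \<bar>y\<bar>))\<^sup>2"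
    by (simp add: power_mult_distrib power2_eq_square exp_minus field_simps flip: exp_add)
  ultimately show "(norm (Gamma ?z))\<^sup>2 \<le> (sqrt (2 * pi) * exp (- pi / 2 * \<bar>y\<bar>))\<^sup>2" by simp
qed auto

text \<open>The line Re z = N = m + 1/2 with N >= c is reached from Re z = 1/2 by m steps of the
  recurrence, and monotonicity in the real part carries its decay to all z with a <= Re z <= c. The
  recurrence costs a polynomial of degree m in |Im z|, paid for by the margin \<epsilon> between
  \<beta> and pi / 2.\<close>

lemma Gamma_decay:
  assumes a: "0 < a" and \<beta>: "\<beta> < pi / 2"
  shows "\<exists>K\<ge>0. \<forall>z. a \<le> Re z \<and> Re z \<le> c \<longrightarrow> norm (Gamma z) \<le> K * exp (- \<beta> * \<bar>Im z\<bar>)"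
proof -
  define \<epsilon> where "\<epsilon> = pi / 2 - \<beta>"
  have \<epsilon>: "\<epsilon> > 0" using \<beta> by (simp add: \<epsilon>_def)
  obtain m :: nat where m: "c \<le> m" "m > 0"
    using reals_Archimedean2[of "max c 1"] by (metis gr0I less_eq_real_def max_less_iff_conj not_one_less_zero of_nat_0)
  define N where "N = 1/2 + real m"
  \<comment> \<open>Chosen so that m + 1 + |y| <= A (1 + \<epsilon> |y| / m): each of the m factors
    of the Pochhammer symbol is bounded by A exp (\<epsilon> |y| / m) and so uses up one m-th of the
    margin.\<close>
  define A where "A = m + 1 + m / \<epsilon>"
  have "compact (Gamma ` {a..N})"
    by (intro compact_continuous_image continuous_intros) (use a in \<open>auto elim!: nonpos_Ints_cases\<close>)
  then obtain K0 where K0: "\<And>x. a \<le> x \<Longrightarrow> x \<le> N \<Longrightarrow> norm (Gamma x :: real) \<le> K0" "K0 > 0"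
    using compact_imp_bounded bounded_pos by (metis atLeastAtMost_iff imageI)
  have GN: "Gamma N > 0" by (intro Gamma_real_pos) (simp add: N_def)
  have A: "A > 0" using \<epsilon> unfolding A_def by (intro add_pos_nonneg) auto
  define K where "K = K0 / Gamma N * (A ^ m * sqrt (2 * pi))"
  have half: "norm (Gamma (Complex N y)) \<le> A ^ m * sqrt (2 * pi) * exp (- \<beta> * \<bar>y\<bar>)" for y
  proof -
    have "Complex (1/2) y \<notin> \<int>\<^sub>\<le>\<^sub>0" by (auto simp: complex_eq_iff elim!: nonpos_Ints_cases)
    then have "Gamma (Complex (1/2) y + of_nat m) = pochhammer (Complex (1/2) y) m * Gamma (Complex (1/2) y)"
      by (simp add: pochhammer_Gamma Gamma_eq_zero_iff)
    moreover have "Complex (1/2) y + of_nat m = Complex N y" by (simp add: complex_eq_iff N_def)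
    moreover have "norm (pochhammer (Complex (1/2) y) m) \<le> A ^ m * exp (\<epsilon> * \<bar>y\<bar>)"
    proof -
      have "norm (pochhammer (Complex (1/2) y) m) = (\<Prod>k=0..<m. norm (Complex (1/2) y + of_nat k))"
        by (simp add: pochhammer_prod prod_norm)
      also have "\<dots> \<le> (\<Prod>k=0..<m. A * exp (\<epsilon> * \<bar>y\<bar> / m))"
      proof (intro prod_mono conjI)
        fix k assume k: "k \<in> {0..<m}"
        have "norm (Complex (1/2) y + of_nat k) \<le> \<bar>1/2 + real k\<bar> + \<bar>y\<bar>"
          using cmod_le[of "Complex (1/2) y + of_nat k"] by simp
        also have "\<dots> \<le> m + 1 + \<bar>y\<bar>" using k by simp
        also have "\<dots> \<le> A * (1 + \<epsilon> * \<bar>y\<bar> / m)"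
        proof -
          have "A * (1 + \<epsilon> * \<bar>y\<bar> / m) = m + 1 + \<bar>y\<bar> + m / \<epsilon> + (m + 1) * \<epsilon> * \<bar>y\<bar> / m"
            using \<epsilon> m by (simp add: A_def field_simps)
          then show ?thesis using \<epsilon> by simp
        qed
        also have "\<dots> \<le> A * exp (\<epsilon> * \<bar>y\<bar> / m)"
          using A exp_ge_add_one_self by (intro mult_left_mono) auto
        finally show "norm (Complex (1/2) y + of_nat k) \<le> A * exp (\<epsilon> * \<bar>y\<bar> / m)" .
      qed auto
      also have "\<dots> = A ^ m * exp (\<epsilon> * \<bar>y\<bar>)"
        using m by (simp add: power_mult_distrib flip: exp_of_nat_mult)
      finally show ?thesis .
    qed
    ultimately have "norm (Gamma (Complex N y)) \<le> (A ^ m * exp (\<epsilon> * \<bar>y\<bar>)) * (sqrt (2 * pi) * exp (- pi / 2 * \<bar>y\<bar>))"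
      using A norm_Gamma_half_le[of y] by (auto simp: norm_mult intro!: mult_mono)
    also have "\<dots> = A ^ m * sqrt (2 * pi) * (exp (\<epsilon> * \<bar>y\<bar>) * exp (- pi / 2 * \<bar>y\<bar>))"
      by simp
    also have "exp (\<epsilon> * \<bar>y\<bar>) * exp (- pi / 2 * \<bar>y\<bar>) = exp (- \<beta> * \<bar>y\<bar>)"
      by (simp add: \<epsilon>_def algebra_simps flip: exp_add)
    finally show ?thesis .
  qed
  have "norm (Gamma z) \<le> K * exp (- \<beta> * \<bar>Im z\<bar>)" if z: "a \<le> Re z" "Re z \<le> c" for z
  proof -
    have le: "Re z \<le> N" using z m by (simp add: N_def)
    have "norm (Gamma z) * Gamma N \<le> Gamma (Re z) * norm (Gamma (Complex N (Im z)))"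
      using norm_Gamma_ratio_mono[of "Re z" N "Im z"] a z le by simp
    also have "\<dots> \<le> K0 * (A ^ m * sqrt (2 * pi) * exp (- \<beta> * \<bar>Im z\<bar>))"
      using K0(1)[of "Re z"] K0(2) half[of "Im z"] z le by (intro mult_mono) auto
    finally show ?thesis using GN by (simp add: K_def field_simps)
  qed
  moreover have "K \<ge> 0" using K0 GN A by (simp add: K_def)
  ultimately show ?thesis by blast
qed

section \<open>The Mellin transform on a strip\<close>

lemma open_vstrip: "open (vstrip b)" and convex_vstrip: "convex (vstrip b)"
proof -
  have eq: "vstrip b = {z. Re z > 0} \<inter> {z. Re z < b}" by (auto simp: vstrip_def)
  show "open (vstrip b)" "convex (vstrip b)"
    unfolding eq by (auto intro!: open_Int convex_Int open_halfspace_Re_gt open_halfspace_Re_lt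
        convex_halfspace_Re_gt convex_halfspace_Re_lt)
qed

definition mellin :: "(real \<Rightarrow> complex) \<Rightarrow> complex \<Rightarrow> complex" where
  "mellin h z = (LINT t:{0<..}|lborel. h t * of_real t powr (z - 1))"

text \<open>The weight \<open>j\<close> is meant for a j-th derivative: t^j times it then obeys the
  same bounds as the function itself. Asking for every \<sigma> in the open interval yields, on each
  fixed line, a better power at 0 and another at infinity.\<close>

definition mellin_decay :: "real \<Rightarrow> real \<Rightarrow> (real \<Rightarrow> complex) \<Rightarrow> bool" where
  "mellin_decay b j h \<longleftrightarrow>
     (\<forall>\<sigma>. 0 < \<sigma> \<and> \<sigma> < b \<longrightarrow> (\<exists>C. \<forall>t>0. norm (h t) \<le> C * t powr (- \<sigma> - j)))"

lemma mellin_decay_diff: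
  assumes "mellin_decay b j h" "mellin_decay b j g"
  shows "mellin_decay b j (\<lambda>t. h t - g t)"
  unfolding mellin_decay_def
proof (intro allI impI)
  fix \<sigma> assume "0 < \<sigma> \<and> \<sigma> < b"
  then obtain C D where C: "\<And>t. 0 < t \<Longrightarrow> norm (h t) \<le> C * t powr (- \<sigma> - j)"
    and D: "\<And>t. 0 < t \<Longrightarrow> norm (g t) \<le> D * t powr (- \<sigma> - j)"
    using assms unfolding mellin_decay_def by meson
  have "norm (h t - g t) \<le> (C + D) * t powr (- \<sigma> - j)" if "0 < t" for t
    using C[OF that] D[OF that] norm_triangle_ineq4[of "h t" "g t"] by (simp add: distrib_right)
  then show "\<exists>C. \<forall>t>0. norm (h t - g t) \<le> C * t powr (- \<sigma> - j)" by blast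
qed

lemma integrable_lborel_inverse_1_plus_square: "integrable lborel (\<lambda>x::real. inverse (1 + x\<^sup>2))"
  using integrable_inverse_1_plus_square by (simp add: set_integrable_def einterval_eq_UNIV)

lemma integrable_exp_minus_abs:
  assumes "(\<epsilon>::real) > 0"
  shows "integrable lborel (\<lambda>s. exp (- \<epsilon> * \<bar>s\<bar>))"
proof -
  \<comment> \<open>The smaller of the coefficients 1 and \<epsilon>^2 / 2 in the quadratic Taylor
    lower bound for exp (\<epsilon> |s|).\<close>
  define m where "m = min 1 (\<epsilon>\<^sup>2 / 2)"
  have m: "m > 0" using assms by (simp add: m_def)
  have "exp (- \<epsilon> * \<bar>s\<bar>) \<le> inverse m * inverse (1 + s\<^sup>2)" for s
  proof -
    have "m * (1 + s\<^sup>2) \<le> 1 + \<epsilon> * \<bar>s\<bar> + (\<epsilon> * \<bar>s\<bar>)\<^sup>2 / 2"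
    proof -
      have "m * s\<^sup>2 \<le> \<epsilon>\<^sup>2 / 2 * s\<^sup>2" by (intro mult_right_mono) (auto simp: m_def)
      moreover have "m \<le> 1" by (simp add: m_def)
      moreover have "\<epsilon> * \<bar>s\<bar> \<ge> 0" using assms by simp
      ultimately show ?thesis by (simp add: distrib_left power_mult_distrib)
    qed
    also have "\<dots> \<le> exp (\<epsilon> * \<bar>s\<bar>)"
      using assms by (intro exp_lower_Taylor_quadratic) auto
    finally have "inverse (exp (\<epsilon> * \<bar>s\<bar>)) \<le> inverse (m * (1 + s\<^sup>2))"
      using m by (intro le_imp_inverse_le mult_pos_pos) (auto intro: add_pos_nonneg)
    then show ?thesis by (simp add: exp_minus)
  qed
  then show ?thesis
    by (intro Bochner_Integration.integrable_bound[OF integrable_mult_right[OF integrable_lborel_inverse_1_plus_square, of "inverse m"]])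
       (use m in \<open>auto simp: abs_mult\<close>)
qed

section \<open>Mellin integrals in the variable s = ln t\<close>

lemma norm_of_real_powr: "t > 0 \<Longrightarrow> norm (of_real t powr w :: complex) = t powr Re w"
  by (simp add: powr_def Ln_of_real)

lemma exp_scaleR_mellin_integrand:
  fixes h :: "real \<Rightarrow> complex"
  shows "exp s *\<^sub>R (h (exp s) * of_real (exp s) powr (z - 1)) = h (exp s) * exp (z * of_real s)"
proof -
  have "of_real (exp s) powr (z - 1) = exp ((z - 1) * of_real s)"
    by (simp add: powr_def Ln_of_real del: of_real_exp)
  then show ?thesis
    by (simp add: scaleR_conv_of_real left_diff_distrib exp_diff flip: exp_of_real)
qed

text \<open>Decay with exponent a - \<epsilon> controls s <= 0 and decay with exponent c +
  \<epsilon> controls s > 0; either leaves a factor exp (- \<epsilon> |s|), and halving the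
  distances to 0 and b keeps both exponents admissible. The constants are uniform in
  \<open>w\<close>, as local domination for holomorphy requires.\<close>

lemma mellin_decay_exp_bound:
  assumes dec: "mellin_decay b j h" and a: "0 < a" "c < b" "a \<le> c"
  obtains K \<epsilon> where "K \<ge> 0" "\<epsilon> > 0" "\<And>s w. a \<le> Re w - j \<Longrightarrow> Re w - j \<le> c \<Longrightarrow>
      norm (h (exp s) * exp (w * of_real s)) \<le> K * exp (- \<epsilon> * \<bar>s\<bar>)"
proof -
  define \<epsilon> where "\<epsilon> = min (a / 2) ((b - c) / 2)"
  have \<epsilon>: "\<epsilon> > 0" using a by (simp add: \<epsilon>_def)
  have "0 < a - \<epsilon>" "a - \<epsilon> < b" "0 < c + \<epsilon>" "c + \<epsilon> < b"
    using a by (auto simp: \<epsilon>_def min_def field_simps)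
  then obtain C1 C2 where C1: "\<And>t. t > 0 \<Longrightarrow> norm (h t) \<le> C1 * t powr (- (a - \<epsilon>) - j)"
    and C2: "\<And>t. t > 0 \<Longrightarrow> norm (h t) \<le> C2 * t powr (- (c + \<epsilon>) - j)"
    using dec unfolding mellin_decay_def by meson
  have "norm (h (exp s) * exp (w * of_real s)) \<le> (\<bar>C1\<bar> + \<bar>C2\<bar>) * exp (- \<epsilon> * \<bar>s\<bar>)"
    if w: "a \<le> Re w - j" "Re w - j \<le> c" for s w
  proof -
    have n: "norm (h (exp s) * exp (w * of_real s)) = norm (h (exp s)) * exp (Re w * s)"
      by (simp add: norm_mult)
    show ?thesis
    proof (cases "s \<le> 0")
      case True
      have "norm (h (exp s)) * exp (Re w * s) \<le> \<bar>C1\<bar> * exp s powr (- (a - \<epsilon>) - j) * exp (Re w * s)"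
        using C1[of "exp s"] by (intro mult_right_mono order_trans[OF C1] mult_right_mono) auto
      also have "\<dots> = \<bar>C1\<bar> * exp (s * (Re w - j - a + \<epsilon>))"
        by (simp add: powr_def algebra_simps flip: exp_add)
      also have "\<dots> \<le> \<bar>C1\<bar> * exp (s * \<epsilon>)"
        using True w by (intro mult_left_mono) (auto intro: mult_left_mono_neg)
      also have "\<dots> \<le> (\<bar>C1\<bar> + \<bar>C2\<bar>) * exp (- \<epsilon> * \<bar>s\<bar>)"
        using True by (simp add: mult.commute distrib_right)
      finally show ?thesis unfolding n .
    next
      case False
      have "norm (h (exp s)) * exp (Re w * s) \<le> \<bar>C2\<bar> * exp s powr (- (c + \<epsilon>) - j) * exp (Re w * s)"
        using C2[of "exp s"] by (intro mult_right_mono order_trans[OF C2] mult_right_mono) auto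
      also have "\<dots> = \<bar>C2\<bar> * exp (s * (Re w - j - c - \<epsilon>))"
        by (simp add: powr_def algebra_simps flip: exp_add)
      also have "\<dots> \<le> \<bar>C2\<bar> * exp (s * (- \<epsilon>))"
        using False w by (intro mult_left_mono) (simp_all only: exp_le_cancel_iff, intro mult_left_mono, auto)
      also have "\<dots> \<le> (\<bar>C1\<bar> + \<bar>C2\<bar>) * exp (- \<epsilon> * \<bar>s\<bar>)"
        using False by (simp add: mult.commute distrib_right)
      finally show ?thesis unfolding n .
    qed
  qed
  then show ?thesis using \<epsilon> that[of "\<bar>C1\<bar> + \<bar>C2\<bar>" \<epsilon>] by auto
qed

lemma mellin_exp_measurable:
  assumes "continuous_on {0<..} h"
  shows "(\<lambda>s. h (exp s) * exp (z * of_real s) :: complex) \<in> borel_measurable lborel"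
proof -
  have "continuous_on UNIV (\<lambda>s. h (exp s) * exp (z * of_real s))"
    by (intro continuous_intros continuous_on_compose2[OF assms]) auto
  then show ?thesis using borel_measurable_continuous_onI by auto
qed

lemma mellin_exp_integrable:
  assumes "continuous_on {0<..} h" "mellin_decay b j h" "j < Re z" "Re z < j + b"
  shows "integrable lborel (\<lambda>s. h (exp s) * exp (z * of_real s))"
proof -
  obtain K \<epsilon> where K: "\<epsilon> > 0" "\<And>s. norm (h (exp s) * exp (z * of_real s)) \<le> K * exp (- \<epsilon> * \<bar>s\<bar>)" "K \<ge> 0"
    using assms mellin_decay_exp_bound[OF assms(2), of "Re z - j" "Re z - j"]
    by (metis add.commute diff_gt_0_iff_gt diff_less_eq order_refl)
  show ?thesis
    by (rule Bochner_Integration.integrable_bound[OF integrable_mult_right[OF integrable_exp_minus_abs[OF K(1)], of K]])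
       (use K mellin_exp_measurable[OF assms(1)] in \<open>auto simp: abs_mult\<close>)
qed

lemma mellin_integrable:
  assumes "continuous_on {0<..} h" "mellin_decay b j h" "j < Re z" "Re z < j + b"
  shows "set_integrable lborel {0<..} (\<lambda>t. h t * of_real t powr (z - 1))"
    and "mellin h z = (LINT s|lborel. h (exp s) * exp (z * of_real s))"
proof -
  have cont: "continuous_on {0<..} (\<lambda>t. h t * of_real t powr (z - 1))"
    using assms(1) by (intro continuous_intros) (auto simp: complex_nonpos_Reals_iff)
  show *: "set_integrable lborel {0<..} (\<lambda>t. h t * of_real t powr (z - 1))"
    unfolding exp_substitution(1)[OF cont] exp_scaleR_mellin_integrand
    by (rule mellin_exp_integrable[OF assms])
  show "mellin h z = (LINT s|lborel. h (exp s) * exp (z * of_real s))"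
    unfolding mellin_def exp_substitution(2)[OF cont *] exp_scaleR_mellin_integrand ..
qed

lemma mellin_holomorphic:
  assumes "continuous_on {0<..} h" "mellin_decay b 0 h"
  shows "mellin h holomorphic_on vstrip b"
proof -
  have "(\<lambda>z. LINT s|lborel. h (exp s) * exp (z * of_real s)) holomorphic_on vstrip b"
  proof (rule holomorphic_on_parametric_integral[OF open_vstrip])
    fix z assume z: "z \<in> vstrip b"
    define r where "r = min (Re z / 2) ((b - Re z) / 2)"
    have r: "r > 0" "0 < Re z - r" "Re z + r < b"
      using z by (auto simp: r_def vstrip_def min_def field_simps)
    have le: "Re z - r \<le> Re z + r" using r by simp
    obtain K \<epsilon> where K: "\<epsilon> > 0" "\<And>s w. Re z - r \<le> Re w \<Longrightarrow> Re w \<le> Re z + r \<Longrightarrow>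
      norm (h (exp s) * exp (w * of_real s)) \<le> K * exp (- \<epsilon> * \<bar>s\<bar>)"
      using mellin_decay_exp_bound[OF assms(2) r(2,3) le] by (metis diff_zero)
    have b: "Re z - r < Re w \<and> Re w < Re z + r" if "w \<in> ball z r" for w
      using that abs_Re_le_cmod[of "z - w"] by (auto simp: dist_norm)
    show "\<exists>r>0. \<exists>g. ball z r \<subseteq> vstrip b \<and> integrable lborel g \<and>
       (\<forall>w\<in>ball z r. \<forall>s\<in>space lborel. norm (h (exp s) * exp (w * of_real s)) \<le> g s)"
    proof (intro exI conjI ballI)
      show "ball z r \<subseteq> vstrip b"
        unfolding vstrip_def using b r by fastforce
      show "integrable lborel (\<lambda>s. K * exp (- \<epsilon> * \<bar>s\<bar>))"
        by (intro integrable_mult_right integrable_exp_minus_abs K)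
      show "norm (h (exp s) * exp (w * of_real s)) \<le> K * exp (- \<epsilon> * \<bar>s\<bar>)" if "w \<in> ball z r" for w s
        using b[OF that] by (intro K) auto
    qed (use r in auto)
  qed (use assms mellin_exp_measurable in \<open>auto intro!: holomorphic_intros\<close>)
  then show ?thesis
    by (rule holomorphic_transform) (use mellin_integrable(2)[OF assms] in \<open>auto simp: vstrip_def\<close>)
qed

text \<open>In the variable s the two Mellin integrands, the second multiplied by z, add up to the
  derivative of \<open>\<Phi>\<close>, and \<open>\<Phi>\<close> vanishes at both ends of the real
  line.\<close>

lemma mellin_by_parts:
  assumes der: "\<And>t. t > 0 \<Longrightarrow> (h has_vector_derivative h' t) (at t)"
    and cont: "continuous_on {0<..} h'"
    and dec: "mellin_decay b j h" "mellin_decay b (j + 1) h'"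
    and z: "j < Re z" "Re z < j + b"
  shows "mellin h' (z + 1) = - z * mellin h z"
proof -
  have conth: "continuous_on {0<..} h"
    using der by (auto intro!: continuous_at_imp_continuous_on has_vector_derivative_continuous)
  define \<Phi> where "\<Phi> = (\<lambda>s. h (exp s) * exp (z * of_real s))"
  define \<Phi>' where "\<Phi>' = (\<lambda>s. h' (exp s) * exp ((z + 1) * of_real s) + z * (h (exp s) * exp (z * of_real s)))"
  have i1: "integrable lborel (\<lambda>s. h' (exp s) * exp ((z + 1) * of_real s))"
    using z by (intro mellin_exp_integrable[OF cont dec(2)]) auto
  have i2: "integrable lborel (\<lambda>s. h (exp s) * exp (z * of_real s))"
    using z by (intro mellin_exp_integrable[OF conth dec(1)]) auto
  obtain K \<epsilon> where K: "\<epsilon> > 0" "\<And>s. norm (\<Phi> s) \<le> K * exp (- \<epsilon> * \<bar>s\<bar>)"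
    using z mellin_decay_exp_bound[OF dec(1), of "Re z - j" "Re z - j"]
    unfolding \<Phi>_def by (metis add.commute diff_gt_0_iff_gt diff_less_eq order_refl)
  have lim: "(\<Phi> \<longlongrightarrow> 0) at_top" "(\<Phi> \<longlongrightarrow> 0) at_bot"
  proof -
    have "((\<lambda>s. K * exp (- \<epsilon> * \<bar>s\<bar>)) \<longlongrightarrow> 0) at_top" "((\<lambda>s. K * exp (- \<epsilon> * \<bar>s\<bar>)) \<longlongrightarrow> 0) at_bot"
      using K(1) by real_asymp+
    then show "(\<Phi> \<longlongrightarrow> 0) at_top" "(\<Phi> \<longlongrightarrow> 0) at_bot"
      using K(2) by (auto intro!: Lim_null_comparison[where f = \<Phi> and g = "\<lambda>s. K * exp (- \<epsilon> * \<bar>s\<bar>)"] always_eventually)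
  qed
  have "(LBINT s=-\<infinity>..\<infinity>. \<Phi>' s) = 0 - 0"
  proof (rule interval_integral_FTC_integrable[where F = \<Phi>])
    fix s :: real
    have d1: "((\<lambda>s. h (exp s)) has_vector_derivative exp s *\<^sub>R h' (exp s)) (at s)"
      using vector_diff_chain_at[of exp "exp s" s h "h' (exp s)"] der[of "exp s"]
      by (simp add: o_def has_real_derivative_iff_has_vector_derivative[symmetric])
    have d2: "((\<lambda>s. exp (z * of_real s)) has_vector_derivative z * exp (z * of_real s)) (at s)"
      by (rule has_vector_derivative_real_field) (auto intro!: derivative_eq_intros)
    show "(\<Phi> has_vector_derivative \<Phi>' s) (at s)"
      using has_vector_derivative_mult[OF d1 d2] unfolding \<Phi>_def \<Phi>'_def
      by (simp add: scaleR_conv_of_real exp_of_real[symmetric] algebra_simps exp_add)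
    have "continuous_on UNIV \<Phi>'"
      unfolding \<Phi>'_def
      by (intro continuous_intros continuous_on_compose2[OF conth] continuous_on_compose2[OF cont]) auto
    then show "isCont \<Phi>' s" by (simp add: continuous_on_eq_continuous_at)
  next
    show "set_integrable lborel (einterval (-\<infinity>) \<infinity>) \<Phi>'"
      using i1 i2 by (simp add: set_integrable_def einterval_eq_UNIV \<Phi>'_def)
    show "((\<Phi> \<circ> real_of_ereal) \<longlongrightarrow> 0) (at_right (-\<infinity>))" "((\<Phi> \<circ> real_of_ereal) \<longlongrightarrow> 0) (at_left \<infinity>)"
      using lim by (simp_all add: ereal_tendsto_simps)
  qed auto
  then have "(LINT s|lborel. \<Phi>' s) = 0"
    by (simp add: interval_lebesgue_integral_def einterval_eq_UNIV set_lebesgue_integral_def)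
  moreover have "mellin h' (z + 1) = (LINT s|lborel. h' (exp s) * exp ((z + 1) * of_real s))"
    by (rule mellin_integrable(2)[OF cont dec(2)]) (use z in auto)
  moreover have "mellin h z = (LINT s|lborel. h (exp s) * exp (z * of_real s))"
    by (rule mellin_integrable(2)[OF conth dec(1)]) (use z in auto)
  ultimately show ?thesis
    unfolding \<Phi>'_def using i1 i2 by (simp add: Bochner_Integration.integral_add eq_neg_iff_add_eq_0)
qed

text \<open>On the line Re z = \<sigma> the Mellin transform of h is the Fourier transform of
  \<open>G\<close>, the function h (exp u) exp (\<sigma> u), so this is Fourier inversion at the
  point ln x.\<close>

lemma mellin_inversion:
  fixes h :: "real \<Rightarrow> complex"
  assumes h: "continuous_on {0<..} h" "mellin_decay b 0 h" and \<sigma>: "0 < \<sigma>" "\<sigma> < b"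
    and int: "integrable lborel (\<lambda>y. mellin h (Complex \<sigma> y))" and x: "x > 0"
  shows "2 * pi * h x = (LINT y|lborel. mellin h (Complex \<sigma> y) * of_real x powr (- Complex \<sigma> y))"
proof -
  define G where "G = (\<lambda>u. h (exp u) * exp (complex_of_real \<sigma> * of_real u))"
  have FG: "(LINT u|lborel. G u * cis (u * y)) = mellin h (Complex \<sigma> y)" for y
  proof -
    have "exp (Complex \<sigma> y * of_real u) = exp (complex_of_real \<sigma> * of_real u) * cis (u * y)" for u
      by (simp add: cis_conv_exp complex_eq_iff algebra_simps flip: exp_add)
         (simp add: Complex_eq algebra_simps)
    then show ?thesis
      using mellin_integrable(2)[OF h, of "Complex \<sigma> y"] \<sigma> by (simp add: G_def mult.assoc)
  qed
  obtain K \<epsilon> where K: "\<epsilon> > 0" "K \<ge> 0" "\<And>s. norm (G s) \<le> K * exp (- \<epsilon> * \<bar>s\<bar>)"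
    using \<sigma> mellin_decay_exp_bound[OF h(2), of \<sigma> \<sigma>] unfolding G_def by (metis Re_complex_of_real diff_zero order_refl)
  have Kb: "norm (G s) \<le> K" for s
    using K by (intro order_trans[OF K(3)]) (auto intro!: mult_left_le)
  have contG: "continuous_on UNIV G"
    unfolding G_def by (intro continuous_intros continuous_on_compose2[OF h(1)]) auto
  have intG: "integrable lborel G"
    unfolding G_def by (rule mellin_exp_integrable[OF h]) (use \<sigma> in auto)
  have "2 * pi * G (ln x) = (LINT y|lborel. mellin h (Complex \<sigma> y) * cis (- (ln x * y)))"
    using fourier_inversion[OF contG Kb intG, of "ln x"] int unfolding FG by simp
  then have "exp (- (complex_of_real \<sigma> * of_real (ln x))) * (2 * pi * G (ln x)) =
      (LINT y|lborel. exp (- (complex_of_real \<sigma> * of_real (ln x))) * (mellin h (Complex \<sigma> y) * cis (- (ln x * y))))"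
    by simp
  moreover have "exp (- (complex_of_real \<sigma> * of_real (ln x))) * (2 * pi * G (ln x)) = 2 * pi * h x"
    using x by (simp add: G_def exp_minus)
  moreover have "exp (- (complex_of_real \<sigma> * of_real (ln x))) * (mellin h (Complex \<sigma> y) * cis (- (ln x * y))) =
      mellin h (Complex \<sigma> y) * of_real x powr (- Complex \<sigma> y)" for y
    using x by (simp add: powr_def Ln_of_real cis_conv_exp mult_ac flip: exp_add)
       (simp add: Complex_eq algebra_simps)
  ultimately show ?thesis by simp
qed

text \<open>Each controlled derivative gains a factor 1 / |Im z| on vertical lines; two are demanded
  because 1 / |Im z| alone is not integrable at infinity.\<close>

definition mellin_smooth :: "real \<Rightarrow> (real \<Rightarrow> complex) \<Rightarrow> bool" where
  "mellin_smooth b h \<longleftrightarrow> (\<exists>h' h''. (\<forall>t>0. (h has_vector_derivative h' t) (at t)) \<and>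
     (\<forall>t>0. (h' has_vector_derivative h'' t) (at t)) \<and> continuous_on {0<..} h'' \<and>
     mellin_decay b 0 h \<and> mellin_decay b 1 h' \<and> mellin_decay b 2 h'')"

lemma mellin_smoothD:
  assumes "mellin_smooth b h"
  shows "continuous_on {0<..} h" "mellin_decay b 0 h"
  using assms unfolding mellin_smooth_def
  by (auto intro!: continuous_at_imp_continuous_on intro: has_vector_derivative_continuous)

lemma mellin_smooth_cong:
  assumes "mellin_smooth b h" "\<And>t. t > 0 \<Longrightarrow> g t = h t"
  shows "mellin_smooth b g"
proof -
  obtain h' h'' where h: "\<And>t. t > 0 \<Longrightarrow> (h has_vector_derivative h' t) (at t)"
     "\<forall>t>0. (h' has_vector_derivative h'' t) (at t)" "continuous_on {0<..} h''"
     and dec: "mellin_decay b 0 h" "mellin_decay b 1 h'" "mellin_decay b 2 h''"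
    using assms(1) unfolding mellin_smooth_def by blast
  have "(g has_vector_derivative h' t) (at t)" if "t > 0" for t
    by (rule has_vector_derivative_transform_within_open[where S = "{0<..}", OF h(1)])
       (use that assms(2) in auto)
  moreover have "mellin_decay b 0 g"
    using dec(1) assms(2) unfolding mellin_decay_def by auto
  ultimately show ?thesis
    unfolding mellin_smooth_def using h dec by blast
qed

text \<open>Two integrations by parts give z (z + 1) mellin h z = mellin h'' (z + 2). The right side
  is bounded on the line by the integral of its exponential majorant, so mellin h decays like 1 / (1
  + y^2).\<close>

lemma mellin_smooth_integrable:
  assumes sm: "mellin_smooth b h" and \<sigma>: "0 < \<sigma>" "\<sigma> < b"
  shows "integrable lborel (\<lambda>y. mellin h (Complex \<sigma> y))"
proof -
  obtain h' h'' where h: "\<And>t. t > 0 \<Longrightarrow> (h has_vector_derivative h' t) (at t)"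
     "\<And>t. t > 0 \<Longrightarrow> (h' has_vector_derivative h'' t) (at t)" "continuous_on {0<..} h''"
     and dec: "mellin_decay b 0 h" "mellin_decay b 1 h'" "mellin_decay b 2 h''"
    using sm unfolding mellin_smooth_def by blast
  have conth': "continuous_on {0<..} h'"
    using h(2) by (auto intro!: continuous_at_imp_continuous_on has_vector_derivative_continuous)
  obtain K \<epsilon> where K: "\<epsilon> > 0" "K \<ge> 0" "\<And>s w. Re w = \<sigma> + 2 \<Longrightarrow> norm (h'' (exp s) * exp (w * of_real s)) \<le> K * exp (- \<epsilon> * \<bar>s\<bar>)"
    using \<sigma> mellin_decay_exp_bound[OF dec(3), of \<sigma> \<sigma>] by (metis add_diff_cancel_right' order_refl)
  define K' where "K' = (LINT s|lborel. K * exp (- \<epsilon> * \<bar>s\<bar>))"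
  have K': "K' \<ge> 0" unfolding K'_def using K by (intro Bochner_Integration.integral_nonneg) auto
  \<comment> \<open>Chosen so that m (1 + y^2) <= \<sigma>^2 + y^2 = |z|^2, whether \<sigma> is
    smaller or larger than 1.\<close>
  define m where "m = min 1 (\<sigma>\<^sup>2)"
  have m: "m > 0" using \<sigma> by (simp add: m_def)
  have bound: "norm (mellin h (Complex \<sigma> y)) \<le> K' / m * inverse (1 + y\<^sup>2)" for y
  proof -
    let ?z = "Complex \<sigma> y"
    have "mellin h'' (?z + 1 + 1) = - (?z + 1) * mellin h' (?z + 1)"
      by (rule mellin_by_parts[OF h(2,3), where b = b and j = 1]) (use \<sigma> dec in auto)
    also have "mellin h' (?z + 1) = - ?z * mellin h ?z"
      by (rule mellin_by_parts[OF h(1) conth', where b = b and j = 0]) (use \<sigma> dec in auto)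
    finally have "norm (?z + 1) * norm ?z * norm (mellin h ?z) = norm (mellin h'' (?z + 1 + 1))"
      by (simp only: norm_mult norm_minus_cancel mult.assoc)
    also have "mellin h'' (?z + 1 + 1) = (LINT s|lborel. h'' (exp s) * exp ((?z + 1 + 1) * of_real s))"
      by (rule mellin_integrable(2)[OF h(3) dec(3)]) (use \<sigma> in auto)
    also have "norm \<dots> \<le> K'"
      unfolding K'_def
      by (intro order_trans[OF integral_norm_bound integral_mono] integrable_norm
            mellin_exp_integrable[OF h(3) dec(3)] integrable_mult_right integrable_exp_minus_abs K)
         (use \<sigma> in auto)
    finally have le: "norm (?z + 1) * norm ?z * norm (mellin h ?z) \<le> K'" .
    have "m * (1 + y\<^sup>2) \<le> \<sigma>\<^sup>2 + y\<^sup>2"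
    proof -
      have "m \<le> \<sigma>\<^sup>2" by (simp add: m_def)
      moreover have "m * y\<^sup>2 \<le> 1 * y\<^sup>2" by (intro mult_right_mono) (auto simp: m_def)
      ultimately show ?thesis by (simp add: distrib_left)
    qed
    also have "\<dots> = norm ?z * norm ?z" by (simp add: cmod_power2 flip: power2_eq_square)
    also have "\<dots> \<le> norm (?z + 1) * norm ?z"
      using \<sigma> by (intro mult_right_mono) (auto simp: cmod_def intro!: real_sqrt_le_mono power_mono)
    finally have "m * (1 + y\<^sup>2) * norm (mellin h ?z) \<le> K'"
      using le by (meson mult_right_mono norm_ge_zero order_trans)
    moreover have "1 + y\<^sup>2 > 0" by (intro add_pos_nonneg) auto
    ultimately have "norm (mellin h ?z) \<le> K' / (m * (1 + y\<^sup>2))"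
      using m by (simp only: pos_le_divide_eq[OF mult_pos_pos] mult_ac)
    then show ?thesis by (simp add: divide_inverse)
  qed
  have "continuous_on (vstrip b) (mellin h)"
    by (intro holomorphic_on_imp_continuous_on mellin_holomorphic mellin_smoothD[OF sm])
  then have "continuous_on UNIV (\<lambda>y. mellin h (Complex \<sigma> y))"
    by (rule continuous_on_compose2) (use \<sigma> in \<open>auto simp: vstrip_def Complex_eq intro!: continuous_intros\<close>)
  then have "(\<lambda>y. mellin h (Complex \<sigma> y)) \<in> borel_measurable lborel"
    using borel_measurable_continuous_onI by auto
  then show ?thesis
    by (rule Bochner_Integration.integrable_bound[OF integrable_mult_right[OF integrable_lborel_inverse_1_plus_square, of "K' / m"]])
       (use bound K' m in \<open>auto simp: abs_mult\<close>)
qed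

section \<open>Weighted iterated integrals\<close>

lemma le_mult_weaken: "x \<le> c * y \<Longrightarrow> c \<le> d \<Longrightarrow> 0 \<le> y \<Longrightarrow> x \<le> d * (y :: real)"
  by (meson mult_right_mono order_trans)

text \<open>The integrating factor exp t turns the equation into w' = exp t * v. For large t the
  function g = exp t * t powr (- p) satisfies g' >= g / 2, so a multiple of g' bounds w', and the
  mean value inequality bounds w by the same multiple of g.\<close>

lemma relaxation_ode_bound:
  fixes u v :: "real \<Rightarrow> complex"
  assumes der: "\<And>t. t > 0 \<Longrightarrow> (u has_vector_derivative (v t - u t)) (at t)"
    and v: "\<And>t. t \<ge> 1 \<Longrightarrow> norm (v t) \<le> C * t powr (- p)"
  shows "\<exists>K. \<forall>t\<ge>1. norm (u t) \<le> K * t powr (- p)"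
proof -
  \<comment> \<open>Beyond 2 p the factor 1 - p / t in g' is at least 1/2.\<close>
  define T where "T = max 1 (2 * p)"
  have T: "T \<ge> 1" "T \<ge> 2 * p" by (auto simp: T_def)
  define w where "w = (\<lambda>t. exp (of_real t) * u t)"
  define g where "g = (\<lambda>t::real. exp t * t powr (- p))"
  \<comment> \<open>The first entry makes K g' dominate the derivative of w, the second makes K g
    dominate w at the starting point T.\<close>
  define K where "K = max (2 * \<bar>C\<bar>) (norm (w T) / g T)"
  have gT: "g T > 0" using T by (simp add: g_def)
  have K: "K \<ge> 2 * \<bar>C\<bar>" "norm (w T) \<le> K * g T"
    using gT by (auto simp: K_def pos_divide_le_eq[symmetric])
  have dw: "(w has_vector_derivative exp (of_real t) * v t) (at t)" if "t > 0" for t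
  proof -
    have "((\<lambda>t. exp (of_real t)) has_vector_derivative exp (complex_of_real t)) (at t)"
      by (rule has_vector_derivative_real_field) (auto intro!: derivative_eq_intros)
    from has_vector_derivative_mult[OF this der[OF that]] show ?thesis
      by (simp add: w_def algebra_simps)
  qed
  have dg: "((\<lambda>t. K * g t) has_vector_derivative K * (g t * (1 - p / t))) (at t)" if "t > 0" for t
    unfolding has_real_derivative_iff_has_vector_derivative[symmetric] g_def using that
    by (auto intro!: derivative_eq_intros simp: field_simps powr_diff)
  have far: "norm (u t) \<le> K * t powr (- p)" if t: "t \<ge> T" for t
  proof -
    have "norm (w t) \<le> K * g t"
    proof (cases "t = T")
      case False
      then have "T < t" using t by simp
      have "norm (w t - w T) \<le> K * g t - K * g T"
      proof (rule differentiable_bound_general[OF \<open>T < t\<close>])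
        show "continuous_on {T..t} w" "continuous_on {T..t} (\<lambda>t. K * g t)"
          using T by (auto intro!: continuous_at_imp_continuous_on has_vector_derivative_continuous[OF dw]
              has_vector_derivative_continuous[OF dg])
        fix x assume x: "T < x" "x < t"
        have x0: "x > 0" using x T by simp
        show "(w has_vector_derivative exp (of_real x) * v x) (at x)" by (rule dw[OF x0])
        show "((\<lambda>t. K * g t) has_vector_derivative K * (g x * (1 - p / x))) (at x)" by (rule dg[OF x0])
        have "norm (v x) \<le> \<bar>C\<bar> * x powr (- p)"
          using x T by (intro le_mult_weaken[OF v[of x]]) auto
        then have "norm (exp (of_real x) * v x) \<le> exp x * (\<bar>C\<bar> * x powr (- p))"
          by (simp add: norm_mult)
        also have "\<dots> = 2 * \<bar>C\<bar> * (g x * (1 / 2))" by (simp add: g_def)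
        also have "\<dots> \<le> K * (g x * (1 - p / x))"
        proof (intro mult_mono)
          show "1 / 2 \<le> 1 - p / x" using x T x0 by (simp add: field_simps)
          show "K \<ge> 0" using K(1) by linarith
        qed (use K x0 in \<open>auto simp: g_def\<close>)
        finally show "norm (exp (of_real x) * v x) \<le> K * (g x * (1 - p / x))" .
      qed
      then show ?thesis using K(2) norm_triangle_ineq2[of "w t" "w T"] by linarith
    qed (use K in auto)
    then have "exp t * norm (u t) \<le> exp t * (K * t powr (- p))"
      by (simp add: w_def norm_mult g_def mult_ac)
    then show ?thesis by simp
  qed
  \<comment> \<open>On the compact interval [1, T] that remains, continuity alone gives a
    bound.\<close>
  have "continuous_on {1..T} (\<lambda>t. u t * of_real (t powr p))"
    by (intro continuous_intros continuous_at_imp_continuous_on ballI has_vector_derivative_continuous[OF der]) auto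
  then have "compact ((\<lambda>t. u t * of_real (t powr p)) ` {1..T})"
    by (intro compact_continuous_image) auto
  then have "bounded ((\<lambda>t. u t * of_real (t powr p)) ` {1..T})"
    by (rule compact_imp_bounded)
  then obtain K2 where "\<forall>t\<in>{1..T}. norm (u t * of_real (t powr p)) \<le> K2"
    unfolding bounded_iff by blast
  then have K2: "norm (u t * of_real (t powr p)) \<le> K2" if "1 \<le> t" "t \<le> T" for t
    using that by simp
  have "norm (u t) \<le> max K K2 * t powr (- p)" if t: "t \<ge> 1" for t
  proof (cases "t \<ge> T")
    case True
    show ?thesis by (rule le_mult_weaken[OF far[OF True]]) auto
  next
    case False
    then have "norm (u t) * t powr p \<le> K2" using K2[of t] t by (simp add: norm_mult)
    then have "norm (u t) \<le> K2 * t powr (- p)" using t by (simp add: powr_minus field_simps)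
    then show ?thesis by (rule le_mult_weaken) auto
  qed
  then show ?thesis by blast
qed

text \<open>The half of \<open>mellin_decay\<close> that the differential equation does not deliver,
  since its estimate starts at t = 1.\<close>

definition mellin_decay_at_0 :: "real \<Rightarrow> real \<Rightarrow> (real \<Rightarrow> complex) \<Rightarrow> bool" where
  "mellin_decay_at_0 b j h \<longleftrightarrow>
     (\<forall>\<sigma>. 0 < \<sigma> \<and> \<sigma> < b \<longrightarrow> (\<exists>C. \<forall>t. 0 < t \<and> t \<le> 1 \<longrightarrow> norm (h t) \<le> C * t powr (- \<sigma> - j)))"

lemma mellin_decay_imp_at_0: "mellin_decay b j h \<Longrightarrow> mellin_decay_at_0 b j h"
  unfolding mellin_decay_def mellin_decay_at_0_def by blast

lemma mellin_decay_at_0_mono: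
  assumes "mellin_decay_at_0 b j h" "j \<le> j'"
  shows "mellin_decay_at_0 b j' h"
  unfolding mellin_decay_at_0_def
proof (intro allI impI)
  fix \<sigma> assume "0 < \<sigma> \<and> \<sigma> < b"
  then obtain C where C: "\<And>t. 0 < t \<and> t \<le> 1 \<Longrightarrow> norm (h t) \<le> C * t powr (- \<sigma> - j)"
    using assms(1) unfolding mellin_decay_at_0_def by blast
  have "norm (h t) \<le> \<bar>C\<bar> * t powr (- \<sigma> - j')" if t: "0 < t \<and> t \<le> 1" for t
  proof -
    have "norm (h t) \<le> \<bar>C\<bar> * t powr (- \<sigma> - j)"
      using C[OF t] by (rule le_mult_weaken) auto
    also have "\<dots> \<le> \<bar>C\<bar> * t powr (- \<sigma> - j')"
      using t assms(2) by (intro mult_left_mono powr_mono') auto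
    finally show ?thesis .
  qed
  then show "\<exists>C. \<forall>t. 0 < t \<and> t \<le> 1 \<longrightarrow> norm (h t) \<le> C * t powr (- \<sigma> - j')" by blast
qed

lemma mellin_decay_at_0_diff:
  assumes "mellin_decay_at_0 b j h" "mellin_decay_at_0 b j g"
  shows "mellin_decay_at_0 b j (\<lambda>t. h t - g t)"
  unfolding mellin_decay_at_0_def
proof (intro allI impI)
  fix \<sigma> assume "0 < \<sigma> \<and> \<sigma> < b"
  then obtain C D where C: "\<And>t. 0 < t \<and> t \<le> 1 \<Longrightarrow> norm (h t) \<le> C * t powr (- \<sigma> - j)"
    and D: "\<And>t. 0 < t \<and> t \<le> 1 \<Longrightarrow> norm (g t) \<le> D * t powr (- \<sigma> - j)"
    using assms unfolding mellin_decay_at_0_def by meson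
  have "norm (h t - g t) \<le> (C + D) * t powr (- \<sigma> - j)" if "0 < t \<and> t \<le> 1" for t
    using C[OF that] D[OF that] norm_triangle_ineq4[of "h t" "g t"] by (simp add: distrib_right)
  then show "\<exists>C. \<forall>t. 0 < t \<and> t \<le> 1 \<longrightarrow> norm (h t - g t) \<le> C * t powr (- \<sigma> - j)" by blast
qed

lemma mellin_decay_at_0_bounded:
  assumes "\<And>t. 0 < t \<Longrightarrow> t \<le> 1 \<Longrightarrow> norm (h t) \<le> M" "j \<ge> 0"
  shows "mellin_decay_at_0 b j h"
  unfolding mellin_decay_at_0_def
proof (intro allI impI)
  fix \<sigma> assume \<sigma>: "0 < \<sigma> \<and> \<sigma> < b"
  have "norm (h t) \<le> M * t powr (- \<sigma> - j)" if t: "0 < t \<and> t \<le> 1" for t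
  proof -
    have "t powr 0 \<le> t powr (- \<sigma> - j)" using t \<sigma> assms(2) by (intro powr_mono') auto
    then have "M * 1 \<le> M * t powr (- \<sigma> - j)"
      using t assms(1)[of t] by (intro mult_left_mono) (auto intro: order_trans[OF norm_ge_zero])
    then show ?thesis using assms(1)[of t] t by simp
  qed
  then show "\<exists>C. \<forall>t. 0 < t \<and> t \<le> 1 \<longrightarrow> norm (h t) \<le> C * t powr (- \<sigma> - j)" by blast
qed

lemma mellin_decay_relaxation_ode:
  assumes der: "\<And>t. t > 0 \<Longrightarrow> (u has_vector_derivative (v t - u t)) (at t)"
    and v: "mellin_decay b j v" and u: "mellin_decay_at_0 b j u"
  shows "mellin_decay b j u"
  unfolding mellin_decay_def
proof (intro allI impI)
  fix \<sigma> assume \<sigma>: "0 < \<sigma> \<and> \<sigma> < b"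
  obtain C1 where C1: "\<And>t. 0 < t \<and> t \<le> 1 \<Longrightarrow> norm (u t) \<le> C1 * t powr (- \<sigma> - j)"
    using u \<sigma> unfolding mellin_decay_at_0_def by blast
  obtain C where "\<And>t. t > 0 \<Longrightarrow> norm (v t) \<le> C * t powr (- \<sigma> - j)"
    using v \<sigma> unfolding mellin_decay_def by blast
  then have "\<exists>K. \<forall>t\<ge>1. norm (u t) \<le> K * t powr (- (\<sigma> + j))"
    by (intro relaxation_ode_bound[where v = v and C = C] der) auto
  then obtain C2 where C2: "\<And>t. t \<ge> 1 \<Longrightarrow> norm (u t) \<le> C2 * t powr (- \<sigma> - j)"
    by auto
  have "norm (u t) \<le> max C1 C2 * t powr (- \<sigma> - j)" if "t > 0" for t
  proof (cases "t \<le> 1")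
    case True
    show ?thesis by (rule le_mult_weaken[OF C1]) (use that True in auto)
  next
    case False
    show ?thesis by (rule le_mult_weaken[OF C2]) (use False in auto)
  qed
  then show "\<exists>C. \<forall>t>0. norm (u t) \<le> C * t powr (- \<sigma> - j)" by blast
qed

section \<open>One integration step for exponentially weighted functions\<close>

lemma exp_weight_cancel: "of_real (exp t) * (of_real (exp (- t)) * c) = (c :: complex)"
  by (simp add: exp_minus)

lemma mellin_smooth_weighted_continuous:
  assumes "mellin_smooth b (\<lambda>t. of_real (exp (- t)) * f t)"
  shows "continuous_on {0<..} f"
proof -
  have "continuous_on {0<..} (\<lambda>t. of_real (exp t) * (of_real (exp (- t)) * f t))"
    by (intro continuous_intros mellin_smoothD[OF assms])
  then show ?thesis by (simp only: exp_weight_cancel)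
qed

lemma int_from_0_exists_mellin_smooth:
  assumes b: "b > 1" and sm: "mellin_smooth b (\<lambda>t. of_real (exp (- t)) * f t)" and x: "x > 0"
  shows "int_from_0_exists f x"
proof -
  have cont: "continuous_on {0<..<x} f"
    using mellin_smooth_weighted_continuous[OF sm] by (rule continuous_on_subset) auto
  \<comment> \<open>The exponent 1/2 lies in (0, b) and below 1, so the bound is integrable at 0; on
    (0, x) removing the weight costs at most a factor exp x.\<close>
  have "\<exists>C. \<forall>t>0. norm (of_real (exp (- t)) * f t) \<le> C * t powr (- (1/2) - 0)"
    using mellin_smoothD(2)[OF sm, unfolded mellin_decay_def, rule_format, of "1/2"] b by simp
  then obtain C where C: "\<And>t. t > 0 \<Longrightarrow> norm (of_real (exp (- t)) * f t) \<le> C * t powr (- (1/2) - 0)"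
    by blast
  have "(\<lambda>t. t powr (-1/2)) absolutely_integrable_on {0..x}"
    using x by (intro nonnegative_absolutely_integrable_1 integrable_on_powr_from_0) auto
  then have "set_integrable lborel {0..x} (\<lambda>t. t powr (-1/2))"
    unfolding set_integrable_def by (subst (asm) integrable_completion) auto
  then have int: "set_integrable lborel {0<..<x} (\<lambda>t. (exp x * \<bar>C\<bar>) * t powr (-1/2))"
    by (intro set_integrable_mult_right impI) (rule set_integrable_subset, auto)
  show ?thesis
    unfolding int_from_0_exists_def
  proof (rule set_integrable_bound[OF int])
    show "set_borel_measurable lborel {0<..<x} f"
      unfolding set_borel_measurable_def using borel_measurable_continuous_on_indicator[OF _ cont] by simp
    have "norm (f t) \<le> norm ((exp x * \<bar>C\<bar>) * t powr (-1/2))" if t: "0 < t" "t < x" for t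
    proof -
      have "norm (f t) = exp t * norm (of_real (exp (- t)) * f t)"
        by (simp add: norm_mult flip: mult.assoc exp_add)
      also have "norm (of_real (exp (- t)) * f t) \<le> \<bar>C\<bar> * t powr (-1/2)"
        using le_mult_weaken[OF C[of t], of "\<bar>C\<bar>"] t by simp
      then have "exp t * norm (of_real (exp (- t)) * f t) \<le> exp x * (\<bar>C\<bar> * t powr (-1/2))"
        using t by (intro mult_mono) auto
      finally show ?thesis by (simp add: abs_mult)
    qed
    then show "AE t in lborel. t \<in> {0<..<x} \<longrightarrow> norm (f t) \<le> norm ((exp x * \<bar>C\<bar>) * t powr (-1/2))" by auto
  qed
qed

lemma int_from_0_eq_integral:
  assumes "int_from_0_exists f x"
  shows "f integrable_on {0..x}" "int_from_0 f x = integral {0..x} f"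
  using set_borel_integral_eq_integral[OF assms[unfolded int_from_0_exists_def]]
  unfolding int_from_0_def
  by (auto simp: integral_open_interval_real integrable_on_open_interval_real)

text \<open>With \<open>h\<^sub>0(t) = e\<^sup>-\<^sup>t f(t)\<close> and \<open>h\<^sub>1(t) = e\<^sup>-\<^sup>t \<integral>\<^sub>0\<^sup>t f\<close> one has \<open>h\<^sub>1' = h\<^sub>0 - h\<^sub>1\<close>; differentiating this
  equation shows that all derivatives of \<open>h\<^sub>1\<close> inherit the decay of those of \<open>h\<^sub>0\<close>.\<close>

lemma int_from_0_weighted_derivative:
  assumes b: "b > 1" and sm: "mellin_smooth b (\<lambda>t. of_real (exp (- t)) * f t)" and t: "t > 0"
  shows "((\<lambda>t. of_real (exp (- t)) * int_from_0 f t) has_vector_derivative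
      of_real (exp (- t)) * f t - of_real (exp (- t)) * int_from_0 f t) (at t)"
proof -
  note ex = int_from_0_exists_mellin_smooth[OF b sm]
  have "((\<lambda>u. integral {0..u} f) has_vector_derivative f t) (at t within {0..t+1} - {})"
  proof (rule integral_has_vector_derivative_continuous_at)
    show "f integrable_on {0..t+1}" using t by (intro int_from_0_eq_integral ex) auto
    have "isCont f t"
      using mellin_smooth_weighted_continuous[OF sm] t by (simp add: continuous_on_eq_continuous_at)
    then show "continuous (at t within {0..t+1} - {}) f" by (rule continuous_at_imp_continuous_at_within)
  qed (use t in auto)
  then have "((\<lambda>u. integral {0..u} f) has_vector_derivative f t) (at t)"
    using t by (simp add: at_within_Icc_at)
  then have d: "(int_from_0 f has_vector_derivative f t) (at t)"
    by (rule has_vector_derivative_transform_within_open[where S = "{0<..}"])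
       (use t int_from_0_eq_integral[OF ex] in auto)
  have "((\<lambda>t. complex_of_real (exp (- t))) has_vector_derivative - of_real (exp (- t))) (at t)"
    by (rule has_vector_derivative_of_real[where D = "- exp (- t)", simplified])
       (auto intro!: derivative_eq_intros)
  from has_vector_derivative_mult[OF this d] show ?thesis by simp
qed

text \<open>The pairs (k, h), (k', h') and (k'', h'') all satisfy u' = v - u, so each member of the
  k family inherits the decay of its partner for large t once it is controlled near 0. Defining k'
  and k'' by the equation makes that control pass from k to k' and k'' by subtraction.\<close>

lemma mellin_smooth_int_from_0:
  assumes b: "b > 1" and sm: "mellin_smooth b (\<lambda>t. of_real (exp (- t)) * f t)"
  shows "mellin_smooth b (\<lambda>t. of_real (exp (- t)) * int_from_0 f t)"
proof -
  define h where "h = (\<lambda>t. of_real (exp (- t)) * f t)"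
  define k where "k = (\<lambda>t. of_real (exp (- t)) * int_from_0 f t)"
  obtain h' h'' where h: "\<And>t. t > 0 \<Longrightarrow> (h has_vector_derivative h' t) (at t)"
     "\<And>t. t > 0 \<Longrightarrow> (h' has_vector_derivative h'' t) (at t)" "continuous_on {0<..} h''"
     and dec: "mellin_decay b 0 h" "mellin_decay b 1 h'" "mellin_decay b 2 h''"
    using sm unfolding mellin_smooth_def h_def by blast
  define k' where "k' = (\<lambda>t. h t - k t)"
  define k'' where "k'' = (\<lambda>t. h' t - k' t)"
  have dk: "(k has_vector_derivative k' t) (at t)" if "t > 0" for t
    using int_from_0_weighted_derivative[OF b sm that] by (simp add: k_def k'_def h_def)
  have dk': "(k' has_vector_derivative k'' t) (at t)" if "t > 0" for t
    unfolding k'_def k''_def by (intro derivative_intros h dk[unfolded k'_def] that)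
  have dk'': "(k'' has_vector_derivative h'' t - k'' t) (at t)" if "t > 0" for t
    unfolding k''_def by (intro derivative_intros h dk'[unfolded k''_def] that)
  \<comment> \<open>The indefinite integral is continuous on the closed interval [0, 1], end point 0
    included, hence bounded there.\<close>
  obtain M where M: "\<And>t. 0 \<le> t \<Longrightarrow> t \<le> 1 \<Longrightarrow> norm (integral {0..t} f) \<le> M"
  proof -
    have "continuous_on {0..1} (\<lambda>t. integral {0..t} f)"
      by (intro indefinite_integral_continuous_1 int_from_0_eq_integral int_from_0_exists_mellin_smooth[OF b sm]) simp
    then have "compact ((\<lambda>t. integral {0..t} f) ` {0..1})"
      by (intro compact_continuous_image) auto
    then have "bounded ((\<lambda>t. integral {0..t} f) ` {0..1})"
      by (rule compact_imp_bounded)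
    then obtain M where "\<forall>t\<in>{0..1}. norm (integral {0..t} f) \<le> M"
      unfolding bounded_iff by blast
    then show ?thesis by (intro that[of M]) auto
  qed
  have "norm (k t) \<le> M" if "0 < t" "t \<le> 1" for t
  proof -
    have "norm (k t) = exp (- t) * norm (integral {0..t} f)"
      using that by (simp add: k_def norm_mult int_from_0_eq_integral[OF int_from_0_exists_mellin_smooth[OF b sm]])
    also have "\<dots> \<le> 1 * M" using that M[of t] by (intro mult_mono) auto
    finally show ?thesis by simp
  qed
  then have k0: "mellin_decay_at_0 b j k" if "j \<ge> 0" for j
    using that by (rule mellin_decay_at_0_bounded)
  have k1: "mellin_decay_at_0 b j k'" if "j \<ge> 0" for j
    unfolding k'_def
    by (intro mellin_decay_at_0_diff k0 that mellin_decay_at_0_mono[OF mellin_decay_imp_at_0[OF dec(1)]])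
  have k2: "mellin_decay_at_0 b 2 k''"
    unfolding k''_def
    by (intro mellin_decay_at_0_diff k1 mellin_decay_at_0_mono[OF mellin_decay_imp_at_0[OF dec(2)]]) auto
  have "mellin_decay b 0 k"
    by (rule mellin_decay_relaxation_ode[OF dk[unfolded k'_def] dec(1) k0]) auto
  moreover have "mellin_decay b 1 k'"
    by (rule mellin_decay_relaxation_ode[OF dk'[unfolded k''_def] dec(2) k1]) auto
  moreover have "mellin_decay b 2 k''"
    by (rule mellin_decay_relaxation_ode[OF dk'' dec(3) k2])
  moreover have "continuous_on {0<..} k''"
    using dk'' by (auto intro!: continuous_at_imp_continuous_on intro: has_vector_derivative_continuous)
  ultimately show ?thesis
    unfolding mellin_smooth_def using dk dk' unfolding k_def by blast
qed

section \<open>Inverse Mellin transforms of exponentially decaying functions\<close>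

text \<open>A primitive on the convex strip replaces the contour integral over rectangles: truncated
  line integrals are increments of \<open>\<Phi>\<close>, and the two lines differ only by the
  increments along the horizontal edges at heights n and -n, where f is exponentially small.\<close>

lemma vline_integral_shift:
  assumes hol: "f holomorphic_on vstrip b" and \<delta>: "\<delta> > 0"
    and bd: "\<And>z. p \<le> Re z \<Longrightarrow> Re z \<le> q \<Longrightarrow> norm (f z) \<le> K * exp (- \<delta> * \<bar>Im z\<bar>)"
    and pq: "0 < p" "p \<le> q" "q < b"
    and int: "integrable lborel (\<lambda>y. f (Complex p y))" "integrable lborel (\<lambda>y. f (Complex q y))"
  shows "(LINT y|lborel. f (Complex p y)) = (LINT y|lborel. f (Complex q y))"
proof -
  obtain \<Phi> where \<Phi>: "\<And>z. z \<in> vstrip b \<Longrightarrow> (\<Phi> has_field_derivative f z) (at z within vstrip b)"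
    using holomorphic_convex_primitive'[OF convex_vstrip open_vstrip hol] by blast
  have \<Phi>at: "(\<Phi> has_field_derivative f z) (at z)" if "z \<in> vstrip b" for z
    using \<Phi>[OF that] that by (simp add: at_within_open[OF _ open_vstrip])
  have lim: "(\<lambda>n. \<Phi> (Complex \<sigma> (real n)) - \<Phi> (Complex \<sigma> (- real n))) \<longlonglongrightarrow> \<i> * (LINT y|lborel. f (Complex \<sigma> y))"
    if \<sigma>: "0 < \<sigma>" "\<sigma> < b" and i: "integrable lborel (\<lambda>y. f (Complex \<sigma> y))" for \<sigma>
  proof -
    have eq: "\<Phi> (Complex \<sigma> (real n)) - \<Phi> (Complex \<sigma> (- real n)) =
        \<i> * (LINT y|lborel. indicator {- real n..real n} y *\<^sub>R f (Complex \<sigma> y))" for n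
    proof -
      have "((\<lambda>y. \<Phi> (Complex \<sigma> y)) has_vector_derivative \<i> * f (Complex \<sigma> y)) (at y)" for y
      proof -
        have "((\<lambda>y. Complex \<sigma> y) has_vector_derivative \<i>) (at y)"
          unfolding Complex_eq by (auto intro!: derivative_eq_intros)
        moreover have "(\<Phi> has_field_derivative f (Complex \<sigma> y)) (at (Complex \<sigma> y))"
          using \<sigma> by (intro \<Phi>at) (auto simp: vstrip_def)
        ultimately show ?thesis
          using field_vector_diff_chain_at[of "Complex \<sigma>" \<i> y \<Phi> "f (Complex \<sigma> y)"] by (simp add: o_def)
      qed
      then have "((\<lambda>y. \<i> * f (Complex \<sigma> y)) has_integral
          (\<Phi> (Complex \<sigma> (real n)) - \<Phi> (Complex \<sigma> (- real n)))) {- real n..real n}"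
        by (intro fundamental_theorem_of_calculus) (auto intro: has_vector_derivative_at_within)
      then have "integral {- real n..real n} (\<lambda>y. \<i> * f (Complex \<sigma> y)) =
          \<Phi> (Complex \<sigma> (real n)) - \<Phi> (Complex \<sigma> (- real n))" by (rule integral_unique)
      moreover have "set_integrable lborel {- real n..real n} (\<lambda>y. \<i> * f (Complex \<sigma> y))"
        using i unfolding set_integrable_def by (intro integrable_mult_indicator) auto
      ultimately have "\<Phi> (Complex \<sigma> (real n)) - \<Phi> (Complex \<sigma> (- real n)) =
          (LINT y:{- real n..real n}|lborel. \<i> * f (Complex \<sigma> y))"
        using set_borel_integral_eq_integral(2) by metis
      then show ?thesis by (simp add: set_lebesgue_integral_def)
    qed
    have "(\<lambda>n. LINT y|lborel. indicator {- real n..real n} y *\<^sub>R f (Complex \<sigma> y)) \<longlonglongrightarrow> (LINT y|lborel. f (Complex \<sigma> y))"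
    proof (rule integral_dominated_convergence[where w = "\<lambda>y. norm (f (Complex \<sigma> y))"])
      show "AE y in lborel. (\<lambda>n. indicator {- real n..real n} y *\<^sub>R f (Complex \<sigma> y)) \<longlonglongrightarrow> f (Complex \<sigma> y)"
      proof (intro AE_I2 tendsto_eventually)
        fix y :: real
        obtain N :: nat where "\<bar>y\<bar> \<le> N" using real_arch_simple by blast
        then have "indicator {- real n..real n} y *\<^sub>R f (Complex \<sigma> y) = f (Complex \<sigma> y)" if "n \<ge> N" for n
          using that by (auto simp: indicator_def)
        then show "\<forall>\<^sub>F n in sequentially. indicator {- real n..real n} y *\<^sub>R f (Complex \<sigma> y) = f (Complex \<sigma> y)"
          using eventually_sequentially by blast
      qed
    qed (use i in \<open>auto simp: indicator_def\<close>)
    then show ?thesis unfolding eq by (intro tendsto_intros)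
  qed
  \<comment> \<open>The sign \<open>s\<close> selects the upper or the lower edge.\<close>
  have edge: "(\<lambda>n. \<Phi> (Complex p (s * real n)) - \<Phi> (Complex q (s * real n))) \<longlonglongrightarrow> 0" if s: "\<bar>s\<bar> = 1" for s
  proof (rule Lim_null_comparison)
    show "(\<lambda>n. K * exp (- \<delta> * real n) * (q - p)) \<longlonglongrightarrow> 0" using \<delta> by real_asymp
    have "norm (\<Phi> (Complex p (s * real n)) - \<Phi> (Complex q (s * real n))) \<le> K * exp (- \<delta> * real n) * (q - p)" for n
    proof -
      define S where "S = {z. Im z = s * real n} \<inter> {z. p \<le> Re z} \<inter> {z. Re z \<le> q}"
      have "norm (\<Phi> (Complex p (s * real n)) - \<Phi> (Complex q (s * real n)))
          \<le> K * exp (- \<delta> * real n) * norm (Complex p (s * real n) - Complex q (s * real n))"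
      proof (rule field_differentiable_bound)
        have "{z. Im z = s * real n} = {z. Im z \<le> s * real n} \<inter> {z. Im z \<ge> s * real n}" by auto
        then show "convex S" unfolding S_def
          by (auto intro!: convex_Int convex_halfspace_Re_le convex_halfspace_Re_ge
              convex_halfspace_Im_le convex_halfspace_Im_ge)
        fix z assume z: "z \<in> S"
        show "(\<Phi> has_field_derivative f z) (at z within S)"
          using z pq by (intro has_field_derivative_at_within[OF \<Phi>at]) (auto simp: S_def vstrip_def)
        show "norm (f z) \<le> K * exp (- \<delta> * real n)"
          using bd[of z] z s by (simp add: S_def abs_mult)
      qed (use pq in \<open>auto simp: S_def\<close>)
      then show ?thesis using pq by (simp add: cmod_def)
    qed
    then show "\<forall>\<^sub>F n in sequentially. norm (\<Phi> (Complex p (s * real n)) - \<Phi> (Complex q (s * real n)))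
        \<le> K * exp (- \<delta> * real n) * (q - p)" by simp
  qed
  have "(\<lambda>n. (\<Phi> (Complex p (real n)) - \<Phi> (Complex p (- real n))) - (\<Phi> (Complex q (real n)) - \<Phi> (Complex q (- real n))))
      \<longlonglongrightarrow> \<i> * (LINT y|lborel. f (Complex p y)) - \<i> * (LINT y|lborel. f (Complex q y))"
    using pq by (intro tendsto_diff lim int) auto
  moreover have "(\<lambda>n. (\<Phi> (Complex p (real n)) - \<Phi> (Complex p (- real n))) - (\<Phi> (Complex q (real n)) - \<Phi> (Complex q (- real n))))
      \<longlonglongrightarrow> 0 - 0"
    using tendsto_diff[OF edge[of 1] edge[of "-1"]] by (simp add: algebra_simps)
  ultimately have "\<i> * (LINT y|lborel. f (Complex p y)) - \<i> * (LINT y|lborel. f (Complex q y)) = 0 - 0"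
    using LIMSEQ_unique by blast
  then show ?thesis by simp
qed

text \<open>Abstracts from \<Gamma>\<phi> / (2 pi). The rate \<gamma> is common to the whole strip,
  while \<open>K\<close> may depend on the closed substrip: the pole of \<Gamma> at 0 rules out a
  uniform constant in general.\<close>

locale strip_decay =
  fixes b \<gamma> :: real and M :: "complex \<Rightarrow> complex"
  assumes hol: "M holomorphic_on vstrip b" and \<gamma>: "\<gamma> > 0"
    and decay: "\<And>p q. 0 < p \<Longrightarrow> q < b \<Longrightarrow>
      \<exists>K\<ge>0. \<forall>z. p \<le> Re z \<and> Re z \<le> q \<longrightarrow> norm (M z) \<le> K * exp (- \<gamma> * \<bar>Im z\<bar>)"
begin

text \<open>Up to the factor \<open>1 / (2\<pi>)\<close> and the substitution \<open>x = e\<^sup>s\<close> this is the inverse Mellin transform of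
  \<open>M\<close>; the exponential decay of \<open>M\<close> makes it analytic in a strip around the real axis.\<close>

definition line_transform :: "real \<Rightarrow> complex \<Rightarrow> complex" where
  "line_transform \<sigma> s = (LINT y|lborel. M (Complex \<sigma> y) * exp (- s * Complex \<sigma> y))"

lemma line_measurable:
  assumes "0 < \<sigma>" "\<sigma> < b"
  shows "continuous_on UNIV (\<lambda>y. M (Complex \<sigma> y))"
    "(\<lambda>y. M (Complex \<sigma> y) * exp (- s * Complex \<sigma> y)) \<in> borel_measurable lborel"
proof -
  have "continuous_on (vstrip b) M" by (rule holomorphic_on_imp_continuous_on[OF hol])
  then show c: "continuous_on UNIV (\<lambda>y. M (Complex \<sigma> y))"
    by (rule continuous_on_compose2) (use assms in \<open>auto simp: vstrip_def Complex_eq intro!: continuous_intros\<close>)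
  have "continuous_on UNIV (\<lambda>y. M (Complex \<sigma> y) * exp (- s * Complex \<sigma> y))"
    unfolding Complex_eq by (intro continuous_intros c[unfolded Complex_eq])
  then show "(\<lambda>y. M (Complex \<sigma> y) * exp (- s * Complex \<sigma> y)) \<in> borel_measurable lborel"
    using borel_measurable_continuous_onI by auto
qed

lemma integrand_bound:
  assumes "norm (M z) \<le> K * exp (- \<gamma> * \<bar>Im z\<bar>)" "\<bar>Im s\<bar> \<le> \<gamma> - \<delta>" "K \<ge> 0"
  shows "norm (M z * exp (- s * z)) \<le> K * exp (- Re z * Re s) * exp (- \<delta> * \<bar>Im z\<bar>)"
proof -
  have "norm (M z * exp (- s * z)) = norm (M z) * exp (- Re z * Re s + Im s * Im z)"
    by (simp add: norm_mult algebra_simps)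
  also have "\<dots> \<le> (K * exp (- \<gamma> * \<bar>Im z\<bar>)) * exp (- Re z * Re s + (\<gamma> - \<delta>) * \<bar>Im z\<bar>)"
  proof (intro mult_mono assms)
    have "Im s * Im z \<le> \<bar>Im s\<bar> * \<bar>Im z\<bar>" by (metis abs_ge_self abs_mult)
    also have "\<dots> \<le> (\<gamma> - \<delta>) * \<bar>Im z\<bar>" using assms by (intro mult_right_mono) auto
    finally show "exp (- Re z * Re s + Im s * Im z) \<le> exp (- Re z * Re s + (\<gamma> - \<delta>) * \<bar>Im z\<bar>)" by simp
  qed (use assms in auto)
  also have "\<dots> = K * (exp (- \<gamma> * \<bar>Im z\<bar>) * exp (- Re z * Re s + (\<gamma> - \<delta>) * \<bar>Im z\<bar>))"
    by simp
  also have "exp (- \<gamma> * \<bar>Im z\<bar>) * exp (- Re z * Re s + (\<gamma> - \<delta>) * \<bar>Im z\<bar>) = exp (- Re z * Re s) * exp (- \<delta> * \<bar>Im z\<bar>)"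
    by (simp add: algebra_simps flip: exp_add)
  finally show ?thesis by simp
qed

lemma line_integrable:
  assumes "0 < \<sigma>" "\<sigma> < b" "\<bar>Im s\<bar> < \<gamma>"
  shows "integrable lborel (\<lambda>y. M (Complex \<sigma> y) * exp (- s * Complex \<sigma> y))"
proof -
  obtain K where K: "K \<ge> 0" "\<And>z. Re z = \<sigma> \<Longrightarrow> norm (M z) \<le> K * exp (- \<gamma> * \<bar>Im z\<bar>)"
    using decay[OF assms(1,2)] by auto
  define \<delta> where "\<delta> = \<gamma> - \<bar>Im s\<bar>"
  have "norm (M (Complex \<sigma> y) * exp (- s * Complex \<sigma> y)) \<le> K * exp (- \<sigma> * Re s) * exp (- \<delta> * \<bar>y\<bar>)" for y
    using integrand_bound[OF K(2)[of "Complex \<sigma> y"], of s \<delta>] K(1) by (simp add: \<delta>_def)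
  then show ?thesis
    by (intro Bochner_Integration.integrable_bound[OF integrable_mult_right[where c = "K * exp (- \<sigma> * Re s)", OF integrable_exp_minus_abs[of \<delta>]]]
         line_measurable AE_I2)
       (use assms K in \<open>auto simp: \<delta>_def abs_mult\<close>)
qed

text \<open>Restricting to half the width of analyticity leaves a decay rate of at least \<gamma> /
  2 in the integrand, hence one constant for all s; the other half gives room for Cauchy circles of
  radius \<gamma> / 2 about real points.\<close>

lemma line_transform_bound:
  assumes "0 < \<sigma>" "\<sigma> < b"
  shows "\<exists>K\<ge>0. \<forall>s. \<bar>Im s\<bar> \<le> \<gamma> / 2 \<longrightarrow> norm (line_transform \<sigma> s) \<le> K * exp (- \<sigma> * Re s)"
proof -
  obtain K where K: "K \<ge> 0" "\<And>z. Re z = \<sigma> \<Longrightarrow> norm (M z) \<le> K * exp (- \<gamma> * \<bar>Im z\<bar>)"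
    using decay[OF assms(1,2)] by auto
  define I where "I = (LINT y|lborel. exp (- (\<gamma> / 2) * \<bar>y\<bar>))"
  have "norm (line_transform \<sigma> s) \<le> K * I * exp (- \<sigma> * Re s)" if s: "\<bar>Im s\<bar> \<le> \<gamma> / 2" for s
  proof -
    have s': "\<bar>Im s\<bar> < \<gamma>" using s \<gamma> by simp
    have "norm (line_transform \<sigma> s) \<le> (LINT y|lborel. norm (M (Complex \<sigma> y) * exp (- s * Complex \<sigma> y)))"
      unfolding line_transform_def by (rule integral_norm_bound)
    also have "\<dots> \<le> (LINT y|lborel. K * exp (- \<sigma> * Re s) * exp (- (\<gamma> / 2) * \<bar>y\<bar>))"
    proof (rule integral_mono)
      show "integrable lborel (\<lambda>y. norm (M (Complex \<sigma> y) * exp (- s * Complex \<sigma> y)))"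
        by (intro integrable_norm line_integrable assms s')
      show "integrable lborel (\<lambda>y. K * exp (- \<sigma> * Re s) * exp (- (\<gamma> / 2) * \<bar>y\<bar>))"
        using \<gamma> by (intro integrable_mult_right integrable_exp_minus_abs) auto
      show "norm (M (Complex \<sigma> y) * exp (- s * Complex \<sigma> y)) \<le> K * exp (- \<sigma> * Re s) * exp (- (\<gamma> / 2) * \<bar>y\<bar>)" for y
        using integrand_bound[OF K(2)[of "Complex \<sigma> y"], of s "\<gamma> / 2"] s K(1) by simp
    qed
    also have "\<dots> = K * I * exp (- \<sigma> * Re s)" by (simp add: I_def)
    finally show ?thesis .
  qed
  moreover have "I \<ge> 0" unfolding I_def by (intro Bochner_Integration.integral_nonneg) auto
  ultimately show ?thesis using K(1) by (intro exI[of _ "K * I"]) auto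
qed

lemma open_transform_strip: "open {s. \<bar>Im s\<bar> < \<gamma>}"
  by (intro open_Collect_less continuous_intros)

lemma line_transform_holomorphic:
  assumes "0 < \<sigma>" "\<sigma> < b"
  shows "line_transform \<sigma> holomorphic_on {s. \<bar>Im s\<bar> < \<gamma>}"
  unfolding line_transform_def
proof (rule holomorphic_on_parametric_integral)
  show "open {s. \<bar>Im s\<bar> < \<gamma>}" by (rule open_transform_strip)
  fix s assume s: "s \<in> {s. \<bar>Im s\<bar> < \<gamma>}"
  obtain K where K: "K \<ge> 0" "\<And>z. Re z = \<sigma> \<Longrightarrow> norm (M z) \<le> K * exp (- \<gamma> * \<bar>Im z\<bar>)"
    using decay[OF assms(1,2)] by auto
  \<comment> \<open>With half the distance to the boundary as radius, every \<open>w\<close> in the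
    ball still leaves the decay rate r in the integrand.\<close>
  define r where "r = (\<gamma> - \<bar>Im s\<bar>) / 2"
  have r: "r > 0" "\<bar>Im s\<bar> + r = \<gamma> - r" using s by (auto simp: r_def field_simps)
  define g where "g = (\<lambda>y. K * exp (\<sigma> * (\<bar>Re s\<bar> + r)) * exp (- r * \<bar>y\<bar>))"
  have near: "\<bar>Im w\<bar> \<le> \<gamma> - r" "- Re w \<le> \<bar>Re s\<bar> + r" if "w \<in> ball s r" for w
    using that abs_Re_le_cmod[of "s - w"] abs_Im_le_cmod[of "s - w"] r by (auto simp: dist_norm)
  have "norm (M (Complex \<sigma> y) * exp (- w * Complex \<sigma> y)) \<le> g y" if w: "w \<in> ball s r" for w y
  proof -
    have "norm (M (Complex \<sigma> y) * exp (- w * Complex \<sigma> y)) \<le> K * exp (- \<sigma> * Re w) * exp (- r * \<bar>y\<bar>)"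
      using integrand_bound[OF K(2)[of "Complex \<sigma> y"] near(1)[OF w]] K(1) by simp
    also have "\<dots> \<le> g y"
      unfolding g_def using K(1) assms mult_left_mono[OF near(2)[OF w], of \<sigma>]
      by (intro mult_right_mono mult_left_mono) auto
    finally show ?thesis .
  qed
  moreover have "ball s r \<subseteq> {s. \<bar>Im s\<bar> < \<gamma>}" using near(1) r by fastforce
  moreover have "integrable lborel g"
    unfolding g_def using r by (intro integrable_mult_right integrable_exp_minus_abs) auto
  ultimately show "\<exists>r>0. \<exists>g. ball s r \<subseteq> {s. \<bar>Im s\<bar> < \<gamma>} \<and> integrable lborel g \<and>
      (\<forall>w\<in>ball s r. \<forall>y\<in>space lborel. norm (M (Complex \<sigma> y) * exp (- w * Complex \<sigma> y)) \<le> g y)"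
    using r(1) by blast
qed (use assms line_measurable in \<open>auto intro!: holomorphic_intros\<close>)

lemma line_transform_shift:
  assumes \<sigma>: "0 < \<sigma>" "\<sigma> < b" and \<tau>: "0 < \<tau>" "\<tau> < b" and s: "\<bar>Im s\<bar> < \<gamma>"
  shows "line_transform \<sigma> s = line_transform \<tau> s"
proof -
  have le: "line_transform p s = line_transform q s" if pq: "0 < p" "p \<le> q" "q < b" for p q
  proof -
    obtain K where K: "K \<ge> 0" "\<And>z. p \<le> Re z \<Longrightarrow> Re z \<le> q \<Longrightarrow> norm (M z) \<le> K * exp (- \<gamma> * \<bar>Im z\<bar>)"
      using decay[OF pq(1,3)] by auto
    define \<delta> where "\<delta> = \<gamma> - \<bar>Im s\<bar>"
    have bd: "norm (M z * exp (- s * z)) \<le> (K * exp (q * \<bar>Re s\<bar>)) * exp (- \<delta> * \<bar>Im z\<bar>)" if z: "p \<le> Re z" "Re z \<le> q" for z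
    proof -
      have "norm (M z * exp (- s * z)) \<le> K * exp (- Re z * Re s) * exp (- \<delta> * \<bar>Im z\<bar>)"
        by (rule integrand_bound[OF K(2)[OF z] _ K(1)]) (simp add: \<delta>_def)
      also have "\<dots> \<le> (K * exp (q * \<bar>Re s\<bar>)) * exp (- \<delta> * \<bar>Im z\<bar>)"
      proof -
        have "- Re z * Re s \<le> \<bar>Re z\<bar> * \<bar>Re s\<bar>" by (metis abs_ge_self abs_minus_cancel abs_mult)
        also have "\<dots> \<le> q * \<bar>Re s\<bar>" using z pq by (intro mult_right_mono) auto
        finally show ?thesis using K(1) by (intro mult_right_mono mult_left_mono) auto
      qed
      finally show ?thesis .
    qed
    show ?thesis
      unfolding line_transform_def
    proof (rule vline_integral_shift[where f = "\<lambda>z. M z * exp (- s * z)"])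
      show "(\<lambda>z. M z * exp (- s * z)) holomorphic_on vstrip b" by (intro holomorphic_intros hol)
      show "\<delta> > 0" using s by (simp add: \<delta>_def)
      show "integrable lborel (\<lambda>y. M (Complex p y) * exp (- s * Complex p y))"
        "integrable lborel (\<lambda>y. M (Complex q y) * exp (- s * Complex q y))"
        using pq s by (intro line_integrable; simp)+
      show "norm (M z * exp (- s * z)) \<le> (K * exp (q * \<bar>Re s\<bar>)) * exp (- \<delta> * \<bar>Im z\<bar>)"
        if "p \<le> Re z" "Re z \<le> q" for z
        by (rule bd[OF that])
    qed (rule pq)+
  qed
  show ?thesis
  proof (cases "\<sigma> \<le> \<tau>")
    case True
    then show ?thesis by (rule le[OF \<sigma>(1) _ \<tau>(2)])
  next
    case False
    then show ?thesis by (intro le[symmetric] \<tau> \<sigma>) simp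
  qed
qed

text \<open>The transform is the same for every line in the strip, so the one defined on \<tau> may
  be estimated on any \<sigma>. Cauchy's inequality on a circle of radius \<gamma> / 2 about s then
  passes the bound to derivatives, at the cost of a factor exp (\<sigma> r) for the leftmost point
  of the circle.\<close>

lemma line_transform_deriv_bound:
  assumes \<tau>: "0 < \<tau>" "\<tau> < b" and \<sigma>: "0 < \<sigma>" "\<sigma> < b"
  shows "\<exists>K. \<forall>s::real. norm ((deriv ^^ n) (line_transform \<tau>) (of_real s)) \<le> K * exp (- \<sigma> * s)"
proof -
  obtain K where K: "K \<ge> 0" "\<And>s. \<bar>Im s\<bar> \<le> \<gamma> / 2 \<Longrightarrow> norm (line_transform \<sigma> s) \<le> K * exp (- \<sigma> * Re s)"
    using line_transform_bound[OF \<sigma>] by blast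
  define r where "r = \<gamma> / 2"
  have r: "r > 0" using \<gamma> by (simp add: r_def)
  have "norm ((deriv ^^ n) (line_transform \<tau>) (of_real s)) \<le> (fact n * (K * exp (\<sigma> * r)) / r ^ n) * exp (- \<sigma> * s)" for s :: real
  proof -
    have sub: "cball (of_real s) r \<subseteq> {s. \<bar>Im s\<bar> < \<gamma>}"
    proof
      fix w :: complex assume "w \<in> cball (of_real s) r"
      then show "w \<in> {s. \<bar>Im s\<bar> < \<gamma>}"
        using abs_Im_le_cmod[of "of_real s - w"] \<gamma> by (simp add: dist_norm r_def)
    qed
    have "norm ((deriv ^^ n) (line_transform \<tau>) (of_real s)) \<le> fact n * (K * exp (\<sigma> * r) * exp (- \<sigma> * s)) / r ^ n"
    proof (rule Cauchy_inequality[OF _ _ r])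
      show "line_transform \<tau> holomorphic_on ball (of_real s) r"
        by (rule holomorphic_on_subset[OF line_transform_holomorphic[OF \<tau>]]) (use sub ball_subset_cball in blast)
      show "continuous_on (cball (of_real s) r) (line_transform \<tau>)"
        by (rule holomorphic_on_imp_continuous_on[OF holomorphic_on_subset[OF line_transform_holomorphic[OF \<tau>] sub]])
      fix w :: complex assume w: "norm (of_real s - w) = r"
      have wi: "\<bar>Im w\<bar> \<le> \<gamma> / 2" "s - r \<le> Re w"
        using w abs_Im_le_cmod[of "of_real s - w"] abs_Re_le_cmod[of "of_real s - w"] by (auto simp: r_def)
      have "norm (line_transform \<tau> w) = norm (line_transform \<sigma> w)"
        using wi \<gamma> by (subst line_transform_shift[OF \<tau> \<sigma>]) auto
      also have "\<dots> \<le> K * exp (- \<sigma> * Re w)" by (rule K(2)[OF wi(1)])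
      also have "\<dots> \<le> K * exp (\<sigma> * r - \<sigma> * s)"
      proof -
        have "\<sigma> * (s - r) \<le> \<sigma> * Re w" using wi \<sigma> by (intro mult_left_mono) auto
        then show ?thesis using K(1) by (intro mult_left_mono) (auto simp: algebra_simps)
      qed
      finally show "norm (line_transform \<tau> w) \<le> K * exp (\<sigma> * r) * exp (- \<sigma> * s)"
        by (simp add: exp_diff exp_minus field_simps)
    qed
    then show ?thesis by (simp add: mult_ac)
  qed
  then show ?thesis by blast
qed

text \<open>Derivatives in t of a function of ln t are combinations of such terms, each
  differentiation contributing a factor 1 / t. The order \<open>n\<close> and the weight
  \<open>j\<close> are independent because the second derivative also contains the first logarithmic
  derivative times t powr (- 2).\<close>

lemma mellin_decay_log_deriv:
  assumes \<tau>: "0 < \<tau>" "\<tau> < b"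
  shows "mellin_decay b j (\<lambda>t. (deriv ^^ n) (line_transform \<tau>) (of_real (ln t)) * of_real (t powr (- j)))"
  unfolding mellin_decay_def
proof (intro allI impI)
  fix \<sigma> assume \<sigma>: "0 < \<sigma> \<and> \<sigma> < b"
  obtain K where K: "\<And>s::real. norm ((deriv ^^ n) (line_transform \<tau>) (of_real s)) \<le> K * exp (- \<sigma> * s)"
    using line_transform_deriv_bound[OF \<tau>] \<sigma> by blast
  have "norm ((deriv ^^ n) (line_transform \<tau>) (of_real (ln t)) * of_real (t powr (- j))) \<le> K * t powr (- \<sigma> - j)"
    if "t > 0" for t
  proof -
    have "norm ((deriv ^^ n) (line_transform \<tau>) (of_real (ln t)) * of_real (t powr (- j))) \<le> K * exp (- \<sigma> * ln t) * t powr (- j)"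
      using K[of "ln t"] by (simp add: norm_mult mult_right_mono)
    also have "\<dots> = K * t powr (- \<sigma> - j)"
      using that by (simp add: powr_def exp_diff exp_minus field_simps)
    finally show ?thesis .
  qed
  then show "\<exists>C. \<forall>t>0. norm ((deriv ^^ n) (line_transform \<tau>) (of_real (ln t)) * of_real (t powr (- j))) \<le> C * t powr (- \<sigma> - j)"
    by blast
qed

lemma line_transform_smooth:
  assumes \<tau>: "0 < \<tau>" "\<tau> < b"
  shows "mellin_smooth b (\<lambda>t. line_transform \<tau> (of_real (ln t)))"
proof -
  define E where "E = (\<lambda>n. (deriv ^^ n) (line_transform \<tau>))"
  have holE: "E n holomorphic_on {s. \<bar>Im s\<bar> < \<gamma>}" for n
    unfolding E_def by (intro holomorphic_higher_deriv open_transform_strip line_transform_holomorphic \<tau>)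
  have dE: "((\<lambda>t. E n (of_real (ln t))) has_vector_derivative E (Suc n) (of_real (ln t)) * of_real (t powr (- 1))) (at t)"
    if t: "t > 0" for n t
  proof -
    have "((\<lambda>t. complex_of_real (ln t)) has_vector_derivative of_real (1 / t)) (at t)"
      by (rule has_vector_derivative_of_real) (use t in \<open>auto intro!: derivative_eq_intros\<close>)
    moreover have "(E n has_field_derivative E (Suc n) (of_real (ln t))) (at (of_real (ln t)))"
      using holomorphic_derivI[OF holE[of n] open_transform_strip, of "of_real (ln t)"] \<gamma> by (simp add: E_def)
    ultimately show ?thesis
      using field_vector_diff_chain_at[of "\<lambda>t. complex_of_real (ln t)" "of_real (1 / t)" t "E n"] t
      by (simp add: o_def powr_minus_divide mult.commute)
  qed
  define h' where "h' = (\<lambda>t. E 1 (of_real (ln t)) * of_real (t powr (- 1)))"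
  define h'' where "h'' = (\<lambda>t. E 2 (of_real (ln t)) * of_real (t powr (- 2)) - E 1 (of_real (ln t)) * of_real (t powr (- 2)))"
  have d1: "((\<lambda>t. line_transform \<tau> (of_real (ln t))) has_vector_derivative h' t) (at t)" if "t > 0" for t
    using dE[OF that, of 0] by (simp add: E_def h'_def)
  have d2: "(h' has_vector_derivative h'' t) (at t)" if t: "t > 0" for t
  proof -
    have p: "t powr (- 1) * t powr (- 1) = t powr (- 2)"
      by (simp only: powr_add[symmetric]) simp
    have "((\<lambda>t. complex_of_real (t powr (- 1))) has_vector_derivative of_real (- (t powr (- 2)))) (at t)"
      by (rule has_vector_derivative_of_real, rule DERIV_cong[OF has_real_derivative_powr[OF t]]) simp
    from has_vector_derivative_mult[OF dE[OF t, of 1] this] show ?thesis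
      unfolding h'_def
    proof (rule has_vector_derivative_eq_rhs)
      show "E 1 (of_real (ln t)) * of_real (- (t powr (- 2))) + E (Suc 1) (of_real (ln t)) * of_real (t powr (- 1)) * of_real (t powr (- 1)) = h'' t"
        unfolding h''_def p[symmetric] of_real_mult of_real_minus Suc_1 by algebra
    qed
  qed
  have "continuous_on {0<..} (\<lambda>t::real. E n (of_real (ln t)))" for n
    by (rule continuous_on_compose2[OF holomorphic_on_imp_continuous_on[OF holE]])
       (use \<gamma> in \<open>auto intro!: continuous_intros\<close>)
  then have "continuous_on {0<..} h''"
    unfolding h''_def by (intro continuous_intros) auto
  moreover have "mellin_decay b 0 (\<lambda>t. line_transform \<tau> (of_real (ln t)))"
    using mellin_decay_log_deriv[OF \<tau>, of 0 0] unfolding mellin_decay_def by simp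
  moreover have "mellin_decay b 1 h'"
    unfolding h'_def E_def by (rule mellin_decay_log_deriv[OF \<tau>])
  moreover have "mellin_decay b 2 h''"
    unfolding h''_def E_def by (intro mellin_decay_diff mellin_decay_log_deriv[OF \<tau>])
  ultimately show ?thesis
    unfolding mellin_smooth_def using d1 d2 by blast
qed

text \<open>The converse direction of inversion, starting from the complex side: the line is moved
  from \<tau> to Re z, and Fourier inversion is applied to M along that line at height Im z.\<close>

lemma mellin_line_transform:
  assumes \<tau>: "0 < \<tau>" "\<tau> < b" and z: "z \<in> vstrip b"
  shows "mellin (\<lambda>t. line_transform \<tau> (of_real (ln t))) z = 2 * pi * M z"
proof -
  let ?h = "\<lambda>t. line_transform \<tau> (of_real (ln t))"
  define \<sigma> where "\<sigma> = Re z"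
  have \<sigma>: "0 < \<sigma>" "\<sigma> < b" using z by (auto simp: \<sigma>_def vstrip_def)
  note sm = mellin_smoothD[OF line_transform_smooth[OF \<tau>]]
  define G where "G = (\<lambda>y. M (Complex \<sigma> y))"
  have FG: "(LINT u|lborel. G u * cis (u * y)) = line_transform \<tau> (of_real (- y)) * exp (complex_of_real \<sigma> * of_real (- y))" for y
  proof -
    have "line_transform \<tau> (of_real (- y)) * exp (complex_of_real \<sigma> * of_real (- y)) =
        line_transform \<sigma> (of_real (- y)) * exp (complex_of_real \<sigma> * of_real (- y))"
      using \<gamma> by (subst line_transform_shift[OF \<tau> \<sigma>]) auto
    also have "\<dots> = (LINT u|lborel. M (Complex \<sigma> u) * exp (- of_real (- y) * Complex \<sigma> u) * exp (complex_of_real \<sigma> * of_real (- y)))"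
      unfolding line_transform_def by (rule integral_mult_left_zero[symmetric])
    also have "\<dots> = (LINT u|lborel. G u * cis (u * y))"
    proof (intro Bochner_Integration.integral_cong refl)
      fix u
      have "exp (- of_real (- y) * Complex \<sigma> u) * exp (complex_of_real \<sigma> * of_real (- y)) = cis (u * y)"
        by (simp add: cis_conv_exp Complex_eq algebra_simps flip: exp_add)
      then show "M (Complex \<sigma> u) * exp (- of_real (- y) * Complex \<sigma> u) * exp (complex_of_real \<sigma> * of_real (- y)) = G u * cis (u * y)"
        by (simp only: G_def mult.assoc)
    qed
    finally show ?thesis ..
  qed
  have intG: "integrable lborel G"
    using line_integrable[OF \<sigma>, of 0] \<gamma> by (simp add: G_def)
  have "integrable lborel (\<lambda>s. line_transform \<tau> (of_real (ln (exp s))) * exp (complex_of_real \<sigma> * of_real s))"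
    by (rule mellin_exp_integrable[OF sm]) (use \<sigma> in auto)
  \<comment> \<open>The Fourier transform of M along the line is the weighted line transform at -y;
    the reflection s = -y brings it to a Mellin integrand whose integrability is known.\<close>
  from lborel_integrable_real_affine[OF this, of "-1" 0]
  have intFG: "integrable lborel (\<lambda>y. LINT u|lborel. G u * cis (u * y))"
    unfolding FG by simp
  obtain K where K: "K \<ge> 0" "\<And>z. Re z = \<sigma> \<Longrightarrow> norm (M z) \<le> K * exp (- \<gamma> * \<bar>Im z\<bar>)"
    using decay[OF \<sigma>] by auto
  have Kb: "norm (G y) \<le> K" for y
    unfolding G_def using K \<gamma> by (intro order_trans[OF K(2)]) (auto intro!: mult_left_le)
  have "2 * pi * M z = 2 * pi * G (Im z)" by (simp add: G_def \<sigma>_def)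
  also have "\<dots> = (LINT y|lborel. line_transform \<tau> (of_real (- y)) * exp (complex_of_real \<sigma> * of_real (- y)) * cis (- (Im z * y)))"
    using fourier_inversion[OF line_measurable(1)[OF \<sigma>, folded G_def] Kb intG intFG, of "Im z"] unfolding FG .
  also have "\<dots> = (LINT s|lborel. line_transform \<tau> (of_real s) * exp (complex_of_real \<sigma> * of_real s) * cis (Im z * s))"
    by (subst lborel_integral_real_affine[where c = "-1" and t = 0]) simp_all
  also have "\<dots> = (LINT s|lborel. ?h (exp s) * exp (z * of_real s))"
  proof (intro Bochner_Integration.integral_cong refl)
    fix s
    have "exp (complex_of_real \<sigma> * of_real s) * cis (Im z * s) = exp (z * of_real s)"
      by (subst (2) complex_eq) (simp add: cis_conv_exp \<sigma>_def algebra_simps flip: exp_add)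
    then show "line_transform \<tau> (of_real s) * exp (complex_of_real \<sigma> * of_real s) * cis (Im z * s) = ?h (exp s) * exp (z * of_real s)"
      by (simp add: mult.assoc)
  qed
  also have "\<dots> = mellin ?h z"
    by (rule mellin_integrable(2)[OF sm, symmetric]) (use \<sigma> in \<open>auto simp: \<sigma>_def\<close>)
  finally show ?thesis ..
qed

end

section \<open>The indefinite sum\<close>

lemma twisted_mellin_eq_mellin:
  "twisted_mellin f z = mellin (\<lambda>t. of_real (exp (- t)) * f t) z / Gamma z"
  by (simp add: twisted_mellin_def mellin_def)

lemma vstrip_Gamma:
  assumes "z \<in> vstrip b"
  shows "z \<notin> \<int>\<^sub>\<le>\<^sub>0" "Gamma z \<noteq> 0" "z \<noteq> 0"
proof -
  show "z \<notin> \<int>\<^sub>\<le>\<^sub>0" using assms by (auto simp: vstrip_def elim!: nonpos_Ints_cases)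
  then show "Gamma z \<noteq> 0" "z \<noteq> 0" by (auto simp: Gamma_eq_zero_iff)
qed

lemma twisted_mellin_exists_smooth:
  assumes "mellin_smooth b (\<lambda>t. of_real (exp (- t)) * f t)" "z \<in> vstrip b"
  shows "twisted_mellin_exists f z"
  unfolding twisted_mellin_exists_def
  by (rule mellin_integrable(1)[OF mellin_smoothD[OF assms(1)]]) (use assms(2) in \<open>auto simp: vstrip_def\<close>)

lemma twisted_mellin_holomorphic:
  assumes "mellin_smooth b (\<lambda>t. of_real (exp (- t)) * f t)"
  shows "twisted_mellin f holomorphic_on vstrip b"
proof -
  have "(\<lambda>z. mellin (\<lambda>t. of_real (exp (- t)) * f t) z / Gamma z) holomorphic_on vstrip b"
    by (intro holomorphic_intros mellin_holomorphic mellin_smoothD[OF assms])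
       (auto dest: vstrip_Gamma)
  then show ?thesis by (simp add: twisted_mellin_eq_mellin[abs_def])
qed

text \<open>With k' = h - k, integration by parts reads mellin h (z + 1) = mellin k (z + 1) - z
  mellin k z; dividing by \<Gamma>(z + 1) = z \<Gamma>(z) removes the factor z.\<close>

lemma twisted_mellin_int_from_0_recurrence:
  assumes b: "b > 1" and sm: "mellin_smooth b (\<lambda>t. of_real (exp (- t)) * f t)"
    and z: "z \<in> vstrip b" "z + 1 \<in> vstrip b"
  shows "twisted_mellin (int_from_0 f) z + twisted_mellin f (z + 1) = twisted_mellin (int_from_0 f) (z + 1)"
proof -
  define h where "h = (\<lambda>t. of_real (exp (- t)) * f t)"
  define k where "k = (\<lambda>t. of_real (exp (- t)) * int_from_0 f t)"
  have smh: "mellin_smooth b h" and smk: "mellin_smooth b k"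
    using sm mellin_smooth_int_from_0[OF b sm] by (auto simp: h_def k_def)
  obtain k' k'' where k: "\<And>t. t > 0 \<Longrightarrow> (k has_vector_derivative k' t) (at t)"
     "\<And>t. t > 0 \<Longrightarrow> (k' has_vector_derivative k'' t) (at t)"
     and dec: "mellin_decay b 0 k" "mellin_decay b 1 k'"
    using smk unfolding mellin_smooth_def by blast
  \<comment> \<open>The derivative supplied by \<open>mellin_smooth\<close> is only known to exist;
    uniqueness of derivatives identifies it.\<close>
  have k': "k' t = h t - k t" if "t > 0" for t
    using vector_derivative_unique_at[OF k(1)[OF that]] int_from_0_weighted_derivative[OF b sm that]
    unfolding h_def k_def by blast
  have cont: "continuous_on {0<..} k'"
    using k(2) by (auto intro!: continuous_at_imp_continuous_on intro: has_vector_derivative_continuous)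
  have "mellin k' (z + 1) = - z * mellin k z"
    by (rule mellin_by_parts[OF k(1) cont, where b = b and j = 0]) (use z dec in \<open>auto simp: vstrip_def\<close>)
  moreover have "mellin k' (z + 1) = mellin h (z + 1) - mellin k (z + 1)"
  proof -
    have "mellin k' (z + 1) = (LINT t:{0<..}|lborel. h t * of_real t powr (z + 1 - 1) - k t * of_real t powr (z + 1 - 1))"
      unfolding mellin_def by (intro set_lebesgue_integral_cong) (auto simp: k' left_diff_distrib)
    also have "\<dots> = mellin h (z + 1) - mellin k (z + 1)"
      unfolding mellin_def
      by (intro set_integral_diff mellin_integrable(1)[OF mellin_smoothD[OF smh]] mellin_integrable(1)[OF mellin_smoothD[OF smk]])
         (use z in \<open>auto simp: vstrip_def\<close>)
    finally show ?thesis .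
  qed
  ultimately have eq: "mellin h (z + 1) = mellin k (z + 1) - z * mellin k z"
    by (simp add: algebra_simps)
  have "Gamma (z + 1) = z * Gamma z" using vstrip_Gamma[OF z(1)] by (intro Gamma_plus1) auto
  then show ?thesis
    unfolding twisted_mellin_eq_mellin h_def[symmetric] k_def[symmetric] eq
    using vstrip_Gamma[OF z(1)] by (simp add: field_simps)
qed

text \<open>Agreement is asked only on the strip because \<psi> may be \<phi> itself, about which
  nothing is known elsewhere. The division by \<Gamma> in the transform cancels the \<Gamma> in the
  inverse, leaving plain Mellin inversion.\<close>

lemma inv_twisted_mellin_inverse:
  assumes sm: "mellin_smooth b (\<lambda>t. of_real (exp (- t)) * f t)"
    and \<psi>: "\<And>z. z \<in> vstrip b \<Longrightarrow> \<psi> z = twisted_mellin f z"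
    and \<sigma>: "0 < \<sigma>" "\<sigma> < b" and x: "x > 0"
  shows "inv_twisted_mellin_exists \<sigma> \<psi> x" "inv_twisted_mellin \<sigma> \<psi> x = f x"
proof -
  define h where "h = (\<lambda>t. of_real (exp (- t)) * f t)"
  have eq: "Gamma (Complex \<sigma> y) * \<psi> (Complex \<sigma> y) * of_real x powr (- Complex \<sigma> y) =
      mellin h (Complex \<sigma> y) * of_real x powr (- Complex \<sigma> y)" for y
  proof -
    have "Complex \<sigma> y \<in> vstrip b" using \<sigma> by (simp add: vstrip_def)
    then show ?thesis
      using vstrip_Gamma[of "Complex \<sigma> y" b] by (simp add: \<psi> twisted_mellin_eq_mellin h_def)
  qed
  have int: "integrable lborel (\<lambda>y. mellin h (Complex \<sigma> y))"
    using mellin_smooth_integrable[OF sm \<sigma>] by (simp add: h_def)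
  have "integrable lborel (\<lambda>y. mellin h (Complex \<sigma> y) * of_real x powr (- Complex \<sigma> y))"
  proof (rule Bochner_Integration.integrable_bound)
    show "integrable lborel (\<lambda>y. of_real (x powr (- \<sigma>)) * mellin h (Complex \<sigma> y))"
      using int by simp
    have "continuous_on UNIV (\<lambda>y. complex_of_real x powr (- Complex \<sigma> y))"
      unfolding Complex_eq using x by (intro continuous_intros) auto
    then have "(\<lambda>y. complex_of_real x powr (- Complex \<sigma> y)) \<in> borel_measurable lborel"
      using borel_measurable_continuous_onI by auto
    then show "(\<lambda>y. mellin h (Complex \<sigma> y) * of_real x powr (- Complex \<sigma> y)) \<in> borel_measurable lborel"
      using int by (intro borel_measurable_times) auto
    show "AE y in lborel. norm (mellin h (Complex \<sigma> y) * of_real x powr (- Complex \<sigma> y))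
        \<le> norm (of_real (x powr (- \<sigma>)) * mellin h (Complex \<sigma> y))"
      using x by (simp add: norm_mult norm_of_real_powr)
  qed
  then show "inv_twisted_mellin_exists \<sigma> \<psi> x"
    unfolding inv_twisted_mellin_exists_def vline_integrable_def eq .
  have "2 * pi * h x = (LINT y|lborel. mellin h (Complex \<sigma> y) * of_real x powr (- Complex \<sigma> y))"
    by (rule mellin_inversion[OF mellin_smoothD[OF sm[folded h_def]] \<sigma> int x])
  then show "inv_twisted_mellin \<sigma> \<psi> x = f x"
    unfolding inv_twisted_mellin_def vline_integral_def eq
    by (simp add: h_def exp_minus field_simps)
qed

text \<open>The start of the induction, where the growth bound on \<phi> is converted into
  smoothness and decay of its inverse transform, and where \<phi> is recovered from that
  transform.\<close>

lemma inv_twisted_mellin_base: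
  assumes hol: "\<phi> holomorphic_on vstrip b" and \<alpha>: "\<alpha> < pi / 2" and C: "C > 0"
    and bd: "\<And>z. z \<in> vstrip b \<Longrightarrow> norm (\<phi> z) < C * exp (\<alpha> * \<bar>Im z\<bar>)"
    and \<tau>: "0 < \<tau>" "\<tau> < b"
  shows "mellin_smooth b (\<lambda>t. of_real (exp (- t)) * inv_twisted_mellin \<tau> \<phi> t)"
    and "z \<in> vstrip b \<Longrightarrow> \<phi> z = twisted_mellin (inv_twisted_mellin \<tau> \<phi>) z"
proof -
  \<comment> \<open>\<beta> is the midpoint of \<alpha> and pi / 2, so \<Gamma> decays at rate
    \<beta> and its product with \<phi> at rate \<beta> - \<alpha> = \<gamma> > 0.\<close>
  define \<beta> where "\<beta> = (pi / 2 + \<alpha>) / 2"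
  define \<gamma> where "\<gamma> = (pi / 2 - \<alpha>) / 2"
  \<comment> \<open>The factor 1 / (2 pi) normalises the inverse transform; the remaining \<i>
    cancels against d\<xi> = \<i> dy.\<close>
  define M where "M = (\<lambda>z. Gamma z * \<phi> z / (2 * pi))"
  interpret strip_decay b \<gamma> M
  proof
    show "M holomorphic_on vstrip b"
      unfolding M_def by (intro holomorphic_intros hol) (auto dest: vstrip_Gamma)
    show "\<gamma> > 0" using \<alpha> by (simp add: \<gamma>_def)
    fix p q :: real assume pq: "0 < p" "q < b"
    have "\<beta> < pi / 2" using \<alpha> by (simp add: \<beta>_def)
    then obtain K where K: "K \<ge> 0"
      "\<And>z. p \<le> Re z \<Longrightarrow> Re z \<le> q \<Longrightarrow> norm (Gamma z) \<le> K * exp (- \<beta> * \<bar>Im z\<bar>)"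
      using Gamma_decay[OF pq(1), of \<beta> q] by blast
    have "norm (M z) \<le> (K * C / (2 * pi)) * exp (- \<gamma> * \<bar>Im z\<bar>)" if z: "p \<le> Re z" "Re z \<le> q" for z
    proof -
      have "z \<in> vstrip b" using z pq by (simp add: vstrip_def)
      then have "norm (Gamma z) * norm (\<phi> z) \<le> (K * exp (- \<beta> * \<bar>Im z\<bar>)) * (C * exp (\<alpha> * \<bar>Im z\<bar>))"
        using K z bd[of z] by (intro mult_mono) auto
      also have "\<dots> = K * C * (exp (- \<beta> * \<bar>Im z\<bar>) * exp (\<alpha> * \<bar>Im z\<bar>))" by simp
      also have "exp (- \<beta> * \<bar>Im z\<bar>) * exp (\<alpha> * \<bar>Im z\<bar>) = exp (- \<gamma> * \<bar>Im z\<bar>)"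
        by (simp add: \<beta>_def \<gamma>_def field_simps flip: exp_add)
      finally show ?thesis
        by (simp add: M_def norm_divide norm_mult divide_right_mono)
    qed
    then show "\<exists>K\<ge>0. \<forall>z. p \<le> Re z \<and> Re z \<le> q \<longrightarrow> norm (M z) \<le> K * exp (- \<gamma> * \<bar>Im z\<bar>)"
      using K(1) C by (intro exI[of _ "K * C / (2 * pi)"]) auto
  qed
  have eq: "of_real (exp (- t)) * inv_twisted_mellin \<tau> \<phi> t = line_transform \<tau> (of_real (ln t))" if t: "t > 0" for t
  proof -
    have "Gamma (Complex \<tau> y) * \<phi> (Complex \<tau> y) * of_real t powr (- Complex \<tau> y) =
        2 * pi * (M (Complex \<tau> y) * exp (- of_real (ln t) * Complex \<tau> y))" for y
      using t by (simp add: M_def powr_def Ln_of_real mult.commute)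
    then show ?thesis
      unfolding inv_twisted_mellin_def vline_integral_def line_transform_def
      by (simp add: exp_minus)
  qed
  show sm: "mellin_smooth b (\<lambda>t. of_real (exp (- t)) * inv_twisted_mellin \<tau> \<phi> t)"
    by (rule mellin_smooth_cong[OF line_transform_smooth[OF \<tau>] eq])
  assume z: "z \<in> vstrip b"
  have "mellin (\<lambda>t. of_real (exp (- t)) * inv_twisted_mellin \<tau> \<phi> t) z = mellin (\<lambda>t. line_transform \<tau> (of_real (ln t))) z"
    unfolding mellin_def by (intro set_lebesgue_integral_cong) (auto simp: eq)
  also have "\<dots> = Gamma z * \<phi> z"
    unfolding mellin_line_transform[OF \<tau> z] by (simp add: M_def)
  finally show "\<phi> z = twisted_mellin (inv_twisted_mellin \<tau> \<phi>) z"
    using vstrip_Gamma[OF z] by (simp add: twisted_mellin_eq_mellin)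
qed

lemma int_from_0_cong:
  assumes "\<And>x. x > 0 \<Longrightarrow> f x = g x"
  shows "int_from_0 f = int_from_0 g" "int_from_0_exists f = int_from_0_exists g"
proof -
  show "int_from_0 f = int_from_0 g"
    unfolding int_from_0_def using assms by (intro ext set_lebesgue_integral_cong) auto
  have "set_integrable lborel {0<..<x} f = set_integrable lborel {0<..<x} g" for x
    using assms by (intro set_integrable_cong) auto
  then show "int_from_0_exists f = int_from_0_exists g"
    unfolding int_from_0_exists_def by (intro ext)
qed

text \<open>The abscissae \<open>\<sigma> k\<close> and \<tau> are unrelated: the functions
  \<open>f k\<close> are built from \<tau> alone, and Mellin inversion recovers each of them on any
  line of the strip.\<close>

theorem corollary2p1:
  fixes b \<alpha> C :: real and \<phi> :: "complex \<Rightarrow> complex"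
  assumes "b > 1"
    and "\<phi> holomorphic_on vstrip b"
    and "\<And>y::real. \<exists>l. ((\<lambda>x. \<phi> (Complex x y)) \<longlongrightarrow> l) (at_right 0)"
    and "0 \<le> \<alpha>" and "\<alpha> < pi / 2" and "C > 0"
    and "\<And>z. z \<in> vstrip b \<Longrightarrow> norm (\<phi> z) < C * exp (\<alpha> * \<bar>Im z\<bar>)"
  shows "\<forall>n\<ge>1. \<forall>(\<sigma> :: nat \<Rightarrow> real) (\<tau> :: real).
    (\<forall>k<n. 0 < \<sigma> k \<and> \<sigma> k < b) \<longrightarrow> 0 < \<tau> \<and> \<tau> < b \<longrightarrow>
      (\<forall>k<n. (\<forall>z\<in>vstrip b. indef_sum_exists (\<sigma> k) (indef_sum_iter \<sigma> k \<phi>) z) \<and>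
             is_indefinite_sum b (indef_sum_iter \<sigma> k \<phi>) (indef_sum_iter \<sigma> (Suc k) \<phi>)) \<and>
      (\<forall>x>0. inv_twisted_mellin_exists \<tau> \<phi> x) \<and>
      (\<forall>k<n. \<forall>x>0. int_from_0_exists ((int_from_0 ^^ k) (inv_twisted_mellin \<tau> \<phi>)) x) \<and>
      (\<forall>z\<in>vstrip b.
         twisted_mellin_exists ((int_from_0 ^^ n) (inv_twisted_mellin \<tau> \<phi>)) z \<and>
         indef_sum_iter \<sigma> n \<phi> z = twisted_mellin ((int_from_0 ^^ n) (inv_twisted_mellin \<tau> \<phi>)) z)"
proof (intro allI impI)
  fix n :: nat and \<sigma> :: "nat \<Rightarrow> real" and \<tau> :: real
  assume \<sigma>: "\<forall>k<n. 0 < \<sigma> k \<and> \<sigma> k < b" and "0 < \<tau> \<and> \<tau> < b"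
  then have \<tau>: "0 < \<tau>" "\<tau> < b" by auto
  define f where "f = (\<lambda>k. (int_from_0 ^^ k) (inv_twisted_mellin \<tau> \<phi>))"
  have f_Suc: "f (Suc k) = int_from_0 (f k)" for k by (simp add: f_def)
  note base = inv_twisted_mellin_base[OF assms(2) assms(5-7) \<tau>]
  have sm: "mellin_smooth b (\<lambda>t. of_real (exp (- t)) * f k t)" for k
  proof (induction k)
    case 0
    show ?case using base(1) by (simp add: f_def)
  next
    case (Suc k)
    then show ?case unfolding f_Suc by (rule mellin_smooth_int_from_0[OF assms(1)])
  qed
  \<comment> \<open>Agreement on the strip suffices as input, yet the output is an equality of
    functions on the whole plane: the inverse transform returns \<open>f k\<close> at every x > 0,
    and the rest of the operator sees nothing else.\<close>
  have step: "indef_sum_iter \<sigma> (Suc k) \<phi> = twisted_mellin (f (Suc k))"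
    if k: "k < n" and IH: "\<And>z. z \<in> vstrip b \<Longrightarrow> indef_sum_iter \<sigma> k \<phi> z = twisted_mellin (f k) z" for k
  proof -
    have "int_from_0 (inv_twisted_mellin (\<sigma> k) (indef_sum_iter \<sigma> k \<phi>)) = int_from_0 (f k)"
      by (rule int_from_0_cong) (use k \<sigma> in \<open>auto intro!: inv_twisted_mellin_inverse[OF sm IH]\<close>)
    then show ?thesis by (intro ext) (simp add: f_Suc indef_sum_def)
  qed
  \<comment> \<open>Stated only for k <= n, since the abscissae are known to lie in (0, b) only
    below n.\<close>
  have iter: "indef_sum_iter \<sigma> k \<phi> z = twisted_mellin (f k) z" if "k \<le> n" "z \<in> vstrip b" for k z
    using that
  proof (induction k arbitrary: z)
    case 0
    then show ?case using base(2) by (simp add: f_def)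
  next
    case (Suc k)
    then show ?case by (subst step) auto
  qed
  have inv: "inv_twisted_mellin_exists (\<sigma> k) (indef_sum_iter \<sigma> k \<phi>) x"
    "inv_twisted_mellin (\<sigma> k) (indef_sum_iter \<sigma> k \<phi>) x = f k x" if "k < n" "x > 0" for k x
    using that \<sigma> iter[of k] by (auto intro!: inv_twisted_mellin_inverse[OF sm[of k]])
  have int: "int_from_0_exists (f k) x" if "x > 0" for k x
    by (rule int_from_0_exists_mellin_smooth[OF assms(1) sm that])
  have "indef_sum_exists (\<sigma> k) (indef_sum_iter \<sigma> k \<phi>) z" if k: "k < n" and z: "z \<in> vstrip b" for k z
    using int_from_0_cong[OF inv(2)[OF k]] inv(1)[OF k] int[of _ k] twisted_mellin_exists_smooth[OF sm z, of "Suc k"]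
    by (simp add: indef_sum_exists_def f_Suc)
  moreover have "is_indefinite_sum b (indef_sum_iter \<sigma> k \<phi>) (indef_sum_iter \<sigma> (Suc k) \<phi>)" if k: "k < n" for k
  proof -
    have Suc: "indef_sum_iter \<sigma> (Suc k) \<phi> = twisted_mellin (f (Suc k))"
      using k by (intro step iter) auto
    show ?thesis
      unfolding is_indefinite_sum_def Suc
      using twisted_mellin_holomorphic[OF sm] twisted_mellin_int_from_0_recurrence[OF assms(1) sm[of k]] k
      by (auto simp: iter simp flip: f_Suc)
  qed
  moreover have "inv_twisted_mellin_exists \<tau> \<phi> x" if "x > 0" for x
    by (rule inv_twisted_mellin_inverse(1)[OF base \<tau> that])
  moreover have "twisted_mellin_exists (f n) z" if "z \<in> vstrip b" for z
    by (rule twisted_mellin_exists_smooth[OF sm that])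
  ultimately show "(\<forall>k<n. (\<forall>z\<in>vstrip b. indef_sum_exists (\<sigma> k) (indef_sum_iter \<sigma> k \<phi>) z) \<and>
             is_indefinite_sum b (indef_sum_iter \<sigma> k \<phi>) (indef_sum_iter \<sigma> (Suc k) \<phi>)) \<and>
      (\<forall>x>0. inv_twisted_mellin_exists \<tau> \<phi> x) \<and>
      (\<forall>k<n. \<forall>x>0. int_from_0_exists ((int_from_0 ^^ k) (inv_twisted_mellin \<tau> \<phi>)) x) \<and>
      (\<forall>z\<in>vstrip b.
         twisted_mellin_exists ((int_from_0 ^^ n) (inv_twisted_mellin \<tau> \<phi>)) z \<and>
         indef_sum_iter \<sigma> n \<phi> z = twisted_mellin ((int_from_0 ^^ n) (inv_twisted_mellin \<tau> \<phi>)) z)"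
    using int iter[of n] unfolding f_def by blast
qed

end
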